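(* Suppose expert 1 has payoff function $u$ and expert 2 has payoff function $\beta u(a,\omega)+(1-\beta)v(a,\omega)$ for some $\beta\in[0,1]$, where $v$ is the decision-maker's payoff function. Then the cheap-talk game has a truthful equilibrium in which expert 1 obtains his commitment value $\mathrm{cav}\,\overline{u}(\pi^\circ)$.
   Context: Notation. $\Omega$ (states) and $A$ (actions) are finite non-empty sets; $\pi^\circ\in\Delta(\Omega)$ is the common prior; $u,v:A\times\Omega\to\mathbb{R}$. $\Delta(X)$ is the set of (discrete) probability distributions on $X$. Payoffs are extended linearly: $u(\alpha,\pi)=\sum_{a,\omega}\alpha(a)\pi(\omega)u(a,\omega)$ for $\alpha\in\Delta(A)$, $\pi\in\Delta(\Omega)$, and likewise $v(\alpha,\pi)$. $BR(\pi)=\{\alpha\in\Delta(A): v(\alpha,\pi)\ge v(\alpha',\pi)\ \forall \alpha'\in\Delta(A)\}$. $\overline{u}(\pi)=\max_{\alpha\in BR(\pi)}u(\alpha,\pi)$, and $\mathrm{cav}\,\overline{u}$ is the concavification of $\overline u$, i.e. the smallest concave function on $\Delta(\Omega)$ that is pointwise $\ge\overline{u}$. The number $\mathrm{cav}\,\overline{u}(\pi^\circ)$ is the commitment value of expert 1. Experiments. A statistical experiment $\sigma$ is a partition of $\Omega\times[0,1]$ into finitely many Lebesgue measurable subsets, called signals. $\Sigma$ is the set of all experiments. The pair $(\omega,x)\in\Omega\times[0,1]$ is drawn from $\pi^\circ\times U[0,1]$, where $U[0,1]$ is uniform; the realized signal of $\sigma$ is the cell $s\in\sigma$ containing $(\omega,x)$.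 Hence the probability of $(s_1,s_2)\in\sigma_1\times\sigma_2$ conditional on $\omega$ is the Lebesgue measure of $\{x:(\omega,x)\in s_1\cap s_2\}$; in particular if both experts choose the same experiment their signals coincide. Cheap-talk game. Stage 1: experts $1,2$ simultaneously choose experiments $\sigma_1,\sigma_2\in\Sigma$, which are publicly observed; then Nature draws $(\omega,x)$. Stage 2: expert $i$ privately observes his signal $s_i\in\sigma_i$ and (simultaneously with the other expert) sends a private message $m_i\in M_i$ to the decision-maker; the message set $M_i$ is rich enough to communicate any signal realization (for every experiment, its signals can be injectively encoded as messages in $M_i$). Stage 3: the decision-maker observes $(\sigma_1,\sigma_2,m_1,m_2)$, but not the signals, and chooses an action. A strategy of expert $i$ is $(\sigma_i,\tau_i)$ with $\sigma_i\in\Sigma$ and $\tau_i(\sigma_i,\sigma_j,s_i)\in\Delta(M_i)$; a strategy of the decision-maker is a map $\alpha$ giving $\alpha(\sigma_1,\sigma_2,m_1,m_2)\in\Delta(A)$. Each choice $(\sigma_1,\sigma_2)$ starts a proper sub-game. Equilibrium means weak perfect Bayesian equilibrium with beliefs consistent with the chosen experiments, also off path: for every $(\sigma_1,\sigma_2)$, (i) after each message pair the decision-maker holds a belief $\pi(m_1,m_2)\in\Delta(\Omega)$, given by Bayes' rule in the sub-game if $(m_1,m_2)$ has positive probability in that sub-game, and otherwise an arbitrary average of posteriors conditional on signal pairs $(s_1,s_2)$ of positive probability; (ii) the decision-maker plays a best-reply $\alpha(\sigma_1,\sigma_2,m_1,m_2)\in BR(\pi(m_1,m_2))$; (iii) each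 expert's message strategy is optimal for his own payoff at each signal of positive probability, given the other strategies; and (iv) at stage 1 no expert gains by choosing another experiment. An equilibrium is truthful if both experts choose the same experiment at stage 1 and truthfully report their common signal realization at stage 2 (following that choice). *)

theory Defs
  imports "HOL-Probability.Probability"
begin

text \<open>
  States and actions are finite types \<open>'w\<close> and \<open>'a\<close>. Distributions on them are points of the
  standard simplex, so that the library's \<^const>\<open>concave_on\<close> and \<^const>\<open>hull\<close> apply; distributions
  on message sets, which are infinite, are \<open>pmf\<close>s.
\<close>

definition Delta :: "(real^'n) set" where
  "Delta = {p. (\<forall>i. 0 \<le> p $ i) \<and> (\<Sum>i\<in>UNIV. p $ i) = 1}"

definition lin_ext :: "('a::finite \<Rightarrow> 'w::finite \<Rightarrow> real) \<Rightarrow> real^'a \<Rightarrow> real^'w \<Rightarrow> real" where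
  "lin_ext w \<alpha> p = (\<Sum>a\<in>UNIV. \<Sum>\<omega>\<in>UNIV. \<alpha> $ a * p $ \<omega> * w a \<omega>)"

definition BR :: "('a::finite \<Rightarrow> 'w::finite \<Rightarrow> real) \<Rightarrow> real^'w \<Rightarrow> (real^'a) set" where
  "BR v p = {\<alpha> \<in> Delta. \<forall>\<alpha>'\<in>Delta. lin_ext v \<alpha>' p \<le> lin_ext v \<alpha> p}"

text \<open>The supremum is a maximum: see \<open>ubar_is_max\<close> below.\<close>

definition ubar ::
  "('a::finite \<Rightarrow> 'w::finite \<Rightarrow> real) \<Rightarrow> ('a \<Rightarrow> 'w \<Rightarrow> real) \<Rightarrow> real^'w \<Rightarrow> real" where
  "ubar u v p = (SUP \<alpha>\<in>BR v p. lin_ext u \<alpha> p)"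

text \<open>
  For \<open>f\<close> bounded above, this is the smallest concave function on \<^const>\<open>Delta\<close> above \<open>f\<close>:
  see \<open>cav_least_concave_majorant\<close> below.
\<close>

definition cav :: "(real^'w \<Rightarrow> real) \<Rightarrow> real^'w \<Rightarrow> real" where
  "cav f p = (INF g \<in> {g. concave_on Delta g \<and> (\<forall>q\<in>Delta. f q \<le> g q)}. g p)"


type_synonym 'w signal = "('w \<times> real) set"
type_synonym 'w stat_experiment = "'w signal set"

definition is_experiment :: "'w::finite stat_experiment \<Rightarrow> bool" where
  "is_experiment \<sigma> \<longleftrightarrow> finite \<sigma> \<and> partition_on (UNIV \<times> {0..1}) \<sigma> \<and>
     (\<forall>s\<in>\<sigma>. s \<in> sets (count_space UNIV \<Otimes>\<^sub>M lebesgue))"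

text \<open>
  Probability that the state is \<open>\<omega>\<close> and \<open>(\<omega>, x)\<close> lies in \<open>E\<close>, when \<open>(\<omega>, x)\<close> is drawn from
  \<open>p \<times> U[0,1]\<close> and \<open>E \<subseteq> UNIV \<times> {0..1}\<close>. A signal pair \<open>(s1, s2)\<close> is the event \<open>E = s1 \<inter> s2\<close>.
\<close>

definition state_prob :: "real^'w \<Rightarrow> 'w::finite signal \<Rightarrow> 'w \<Rightarrow> real" where
  "state_prob p E \<omega> = p $ \<omega> * measure lebesgue {x. (\<omega>, x) \<in> E}"

definition event_prob :: "real^'w \<Rightarrow> 'w::finite signal \<Rightarrow> real" where
  "event_prob p E = (\<Sum>\<omega>\<in>UNIV. state_prob p E \<omega>)"

definition posterior :: "real^'w \<Rightarrow> 'w::finite signal \<Rightarrow> real^'w" where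
  "posterior p E = (\<chi> \<omega>. state_prob p E \<omega> / event_prob p E)"


text \<open>
  A sub-game is given by a pair of experiments \<open>\<sigma>1\<close>, \<open>\<sigma>2\<close>. In it, \<open>t1\<close>, \<open>t2\<close> are the experts'
  message strategies, \<open>act\<close> is the decision-maker's strategy and \<open>bel\<close> the decision-maker's
  belief system.
\<close>

definition state_msg_prob ::
  "real^'w \<Rightarrow> 'w::finite stat_experiment \<Rightarrow> 'w stat_experiment \<Rightarrow>
   ('w signal \<Rightarrow> 'm1 pmf) \<Rightarrow> ('w signal \<Rightarrow> 'm2 pmf) \<Rightarrow> 'm1 \<Rightarrow> 'm2 \<Rightarrow> 'w \<Rightarrow> real" where
  "state_msg_prob p \<sigma>1 \<sigma>2 t1 t2 m1 m2 \<omega> =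
     (\<Sum>s1\<in>\<sigma>1. \<Sum>s2\<in>\<sigma>2. state_prob p (s1 \<inter> s2) \<omega> * pmf (t1 s1) m1 * pmf (t2 s2) m2)"

definition msg_prob ::
  "real^'w \<Rightarrow> 'w::finite stat_experiment \<Rightarrow> 'w stat_experiment \<Rightarrow>
   ('w signal \<Rightarrow> 'm1 pmf) \<Rightarrow> ('w signal \<Rightarrow> 'm2 pmf) \<Rightarrow> 'm1 \<Rightarrow> 'm2 \<Rightarrow> real" where
  "msg_prob p \<sigma>1 \<sigma>2 t1 t2 m1 m2 = (\<Sum>\<omega>\<in>UNIV. state_msg_prob p \<sigma>1 \<sigma>2 t1 t2 m1 m2 \<omega>)"

definition consistent_belief ::
  "real^'w \<Rightarrow> 'w::finite stat_experiment \<Rightarrow> 'w stat_experiment \<Rightarrow>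
   ('w signal \<Rightarrow> 'm1 pmf) \<Rightarrow> ('w signal \<Rightarrow> 'm2 pmf) \<Rightarrow> 'm1 \<Rightarrow> 'm2 \<Rightarrow> real^'w \<Rightarrow> bool" where
  "consistent_belief p \<sigma>1 \<sigma>2 t1 t2 m1 m2 q \<longleftrightarrow>
     (if 0 < msg_prob p \<sigma>1 \<sigma>2 t1 t2 m1 m2
      then q = (\<chi> \<omega>. state_msg_prob p \<sigma>1 \<sigma>2 t1 t2 m1 m2 \<omega> / msg_prob p \<sigma>1 \<sigma>2 t1 t2 m1 m2)
      else q \<in> convex hull
             {posterior p (s1 \<inter> s2) |s1 s2. s1 \<in> \<sigma>1 \<and> s2 \<in> \<sigma>2 \<and> 0 < event_prob p (s1 \<inter> s2)})"

text \<open>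
  Expected payoff in state \<open>\<omega>\<close>, for payoff function \<open>w\<close>, when the messages are drawn
  independently from \<open>\<mu>1\<close> and \<open>\<mu>2\<close>.
\<close>

definition msg_payoff ::
  "('a::finite \<Rightarrow> 'w::finite \<Rightarrow> real) \<Rightarrow> ('m1 \<Rightarrow> 'm2 \<Rightarrow> real^'a) \<Rightarrow> 'm1 pmf \<Rightarrow> 'm2 pmf \<Rightarrow> 'w \<Rightarrow> real" where
  "msg_payoff w act \<mu>1 \<mu>2 \<omega> =
     measure_pmf.expectation \<mu>1 (\<lambda>m1. measure_pmf.expectation \<mu>2 (\<lambda>m2.
       \<Sum>a\<in>UNIV. act m1 m2 $ a * w a \<omega>))"

definition payoff ::
  "real^'w \<Rightarrow> ('a::finite \<Rightarrow> 'w::finite \<Rightarrow> real) \<Rightarrow> 'w stat_experiment \<Rightarrow> 'w stat_experiment \<Rightarrow>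
   ('w signal \<Rightarrow> 'm1 pmf) \<Rightarrow> ('w signal \<Rightarrow> 'm2 pmf) \<Rightarrow> ('m1 \<Rightarrow> 'm2 \<Rightarrow> real^'a) \<Rightarrow> real" where
  "payoff p w \<sigma>1 \<sigma>2 t1 t2 act =
     (\<Sum>s1\<in>\<sigma>1. \<Sum>s2\<in>\<sigma>2. \<Sum>\<omega>\<in>UNIV.
        state_prob p (s1 \<inter> s2) \<omega> * msg_payoff w act (t1 s1) (t2 s2) \<omega>)"

text \<open>
  Expected payoff of expert 1 (resp. 2) conditional on his own signal being \<open>s1\<close> (resp. \<open>s2\<close>),
  when he draws his message from \<open>\<mu>\<close>.
\<close>

definition interim_payoff1 ::
  "real^'w \<Rightarrow> ('a::finite \<Rightarrow> 'w::finite \<Rightarrow> real) \<Rightarrow> 'w stat_experiment \<Rightarrow>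
   ('w signal \<Rightarrow> 'm2 pmf) \<Rightarrow> ('m1 \<Rightarrow> 'm2 \<Rightarrow> real^'a) \<Rightarrow> 'w signal \<Rightarrow> 'm1 pmf \<Rightarrow> real" where
  "interim_payoff1 p w \<sigma>2 t2 act s1 \<mu> =
     (\<Sum>s2\<in>\<sigma>2. \<Sum>\<omega>\<in>UNIV. state_prob p (s1 \<inter> s2) \<omega> * msg_payoff w act \<mu> (t2 s2) \<omega>)
       / event_prob p s1"

definition interim_payoff2 ::
  "real^'w \<Rightarrow> ('a::finite \<Rightarrow> 'w::finite \<Rightarrow> real) \<Rightarrow> 'w stat_experiment \<Rightarrow>
   ('w signal \<Rightarrow> 'm1 pmf) \<Rightarrow> ('m1 \<Rightarrow> 'm2 \<Rightarrow> real^'a) \<Rightarrow> 'w signal \<Rightarrow> 'm2 pmf \<Rightarrow> real" where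
  "interim_payoff2 p w \<sigma>1 t1 act s2 \<mu> =
     (\<Sum>s1\<in>\<sigma>1. \<Sum>\<omega>\<in>UNIV. state_prob p (s1 \<inter> s2) \<omega> * msg_payoff w act (t1 s1) \<mu> \<omega>)
       / event_prob p s2"

text \<open>
  The equilibrium conditions within one sub-game. Here \<open>w1\<close>, \<open>w2\<close> are the experts' payoff
  functions and \<open>v\<close> that of the decision-maker.
\<close>

definition subgame_equilibrium ::
  "real^'w \<Rightarrow> ('a::finite \<Rightarrow> 'w::finite \<Rightarrow> real) \<Rightarrow> ('a \<Rightarrow> 'w \<Rightarrow> real) \<Rightarrow> ('a \<Rightarrow> 'w \<Rightarrow> real) \<Rightarrow>
   'm1 set \<Rightarrow> 'm2 set \<Rightarrow> 'w stat_experiment \<Rightarrow> 'w stat_experiment \<Rightarrow>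
   ('w signal \<Rightarrow> 'm1 pmf) \<Rightarrow> ('w signal \<Rightarrow> 'm2 pmf) \<Rightarrow>
   ('m1 \<Rightarrow> 'm2 \<Rightarrow> real^'a) \<Rightarrow> ('m1 \<Rightarrow> 'm2 \<Rightarrow> real^'w) \<Rightarrow> bool" where
  "subgame_equilibrium p w1 w2 v M1 M2 \<sigma>1 \<sigma>2 t1 t2 act bel \<longleftrightarrow>
     (\<forall>s1\<in>\<sigma>1. set_pmf (t1 s1) \<subseteq> M1) \<and>
     (\<forall>s2\<in>\<sigma>2. set_pmf (t2 s2) \<subseteq> M2) \<and>
     (\<forall>m1\<in>M1. \<forall>m2\<in>M2.
        consistent_belief p \<sigma>1 \<sigma>2 t1 t2 m1 m2 (bel m1 m2) \<and>
        act m1 m2 \<in> BR v (bel m1 m2)) \<and>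
     (\<forall>s1\<in>\<sigma>1. 0 < event_prob p s1 \<longrightarrow> (\<forall>\<mu>. set_pmf \<mu> \<subseteq> M1 \<longrightarrow>
        interim_payoff1 p w1 \<sigma>2 t2 act s1 \<mu> \<le> interim_payoff1 p w1 \<sigma>2 t2 act s1 (t1 s1))) \<and>
     (\<forall>s2\<in>\<sigma>2. 0 < event_prob p s2 \<longrightarrow> (\<forall>\<mu>. set_pmf \<mu> \<subseteq> M2 \<longrightarrow>
        interim_payoff2 p w2 \<sigma>1 t1 act s2 \<mu> \<le> interim_payoff2 p w2 \<sigma>1 t1 act s2 (t2 s2)))"

text \<open>
  In \<open>\<tau>1\<close> and \<open>\<tau>2\<close> the expert's own experiment comes first; in \<open>\<alpha>\<close> and \<open>bel\<close> the experiment
  of expert 1 comes first. The final conjunct is optimality at stage 1.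
\<close>

definition equilibrium ::
  "real^'w \<Rightarrow> ('a::finite \<Rightarrow> 'w::finite \<Rightarrow> real) \<Rightarrow> ('a \<Rightarrow> 'w \<Rightarrow> real) \<Rightarrow> ('a \<Rightarrow> 'w \<Rightarrow> real) \<Rightarrow>
   'm1 set \<Rightarrow> 'm2 set \<Rightarrow>
   'w stat_experiment \<Rightarrow> ('w stat_experiment \<Rightarrow> 'w stat_experiment \<Rightarrow> 'w signal \<Rightarrow> 'm1 pmf) \<Rightarrow>
   'w stat_experiment \<Rightarrow> ('w stat_experiment \<Rightarrow> 'w stat_experiment \<Rightarrow> 'w signal \<Rightarrow> 'm2 pmf) \<Rightarrow>
   ('w stat_experiment \<Rightarrow> 'w stat_experiment \<Rightarrow> 'm1 \<Rightarrow> 'm2 \<Rightarrow> real^'a) \<Rightarrow>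
   ('w stat_experiment \<Rightarrow> 'w stat_experiment \<Rightarrow> 'm1 \<Rightarrow> 'm2 \<Rightarrow> real^'w) \<Rightarrow> bool" where
  "equilibrium p w1 w2 v M1 M2 \<sigma>1 \<tau>1 \<sigma>2 \<tau>2 \<alpha> bel \<longleftrightarrow>
     is_experiment \<sigma>1 \<and> is_experiment \<sigma>2 \<and>
     (\<forall>\<rho>1 \<rho>2. is_experiment \<rho>1 \<longrightarrow> is_experiment \<rho>2 \<longrightarrow>
        subgame_equilibrium p w1 w2 v M1 M2 \<rho>1 \<rho>2 (\<tau>1 \<rho>1 \<rho>2) (\<tau>2 \<rho>2 \<rho>1) (\<alpha> \<rho>1 \<rho>2) (bel \<rho>1 \<rho>2)) \<and>
     (\<forall>\<rho>1. is_experiment \<rho>1 \<longrightarrow>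
        payoff p w1 \<rho>1 \<sigma>2 (\<tau>1 \<rho>1 \<sigma>2) (\<tau>2 \<sigma>2 \<rho>1) (\<alpha> \<rho>1 \<sigma>2)
          \<le> payoff p w1 \<sigma>1 \<sigma>2 (\<tau>1 \<sigma>1 \<sigma>2) (\<tau>2 \<sigma>2 \<sigma>1) (\<alpha> \<sigma>1 \<sigma>2)) \<and>
     (\<forall>\<rho>2. is_experiment \<rho>2 \<longrightarrow>
        payoff p w2 \<sigma>1 \<rho>2 (\<tau>1 \<sigma>1 \<rho>2) (\<tau>2 \<rho>2 \<sigma>1) (\<alpha> \<sigma>1 \<rho>2)
          \<le> payoff p w2 \<sigma>1 \<sigma>2 (\<tau>1 \<sigma>1 \<sigma>2) (\<tau>2 \<sigma>2 \<sigma>1) (\<alpha> \<sigma>1 \<sigma>2))"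

text \<open>
  Richness of a message set, witnessed by \<open>enc\<close>: the message \<open>enc \<sigma> s\<close> stands for the signal
  \<open>s\<close> of \<open>\<sigma>\<close>.
\<close>

definition signal_encoding :: "'m set \<Rightarrow> ('w::finite stat_experiment \<Rightarrow> 'w signal \<Rightarrow> 'm) \<Rightarrow> bool" where
  "signal_encoding M enc \<longleftrightarrow>
     (\<forall>\<sigma>. is_experiment \<sigma> \<longrightarrow> inj_on (enc \<sigma>) \<sigma> \<and> enc \<sigma> ` \<sigma> \<subseteq> M)"

definition truthful ::
  "('w::finite stat_experiment \<Rightarrow> 'w signal \<Rightarrow> 'm1) \<Rightarrow> ('w stat_experiment \<Rightarrow> 'w signal \<Rightarrow> 'm2) \<Rightarrow>
   'w stat_experiment \<Rightarrow> ('w stat_experiment \<Rightarrow> 'w stat_experiment \<Rightarrow> 'w signal \<Rightarrow> 'm1 pmf) \<Rightarrow>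
   'w stat_experiment \<Rightarrow> ('w stat_experiment \<Rightarrow> 'w stat_experiment \<Rightarrow> 'w signal \<Rightarrow> 'm2 pmf) \<Rightarrow> bool" where
  "truthful enc1 enc2 \<sigma>1 \<tau>1 \<sigma>2 \<tau>2 \<longleftrightarrow>
     \<sigma>1 = \<sigma>2 \<and>
     (\<forall>s\<in>\<sigma>1. \<tau>1 \<sigma>1 \<sigma>2 s = return_pmf (enc1 \<sigma>1 s) \<and> \<tau>2 \<sigma>2 \<sigma>1 s = return_pmf (enc2 \<sigma>2 s))"


lemma Delta_le_1: "p \<in> Delta \<Longrightarrow> p $ i \<le> 1"
  unfolding Delta_def by (metis (mono_tags, lifting) UNIV_I finite mem_Collect_eq member_le_sum)

lemma compact_Delta: "compact (Delta :: (real^'n) set)"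
proof -
  have "closed (Delta :: (real^'n) set)"
  proof -
    have "Delta = (\<Inter>i. {p :: real^'n. 0 \<le> p $ i}) \<inter> {p. (\<Sum>i\<in>UNIV. p $ i) = 1}"
      by (auto simp: Delta_def)
    also have "closed \<dots>"
      by (intro closed_Int closed_INT ballI closed_Collect_le closed_Collect_eq continuous_intros)
    finally show ?thesis .
  qed
  moreover have "Delta \<subseteq> cbox (0 :: real^'n) 1"
    using Delta_le_1 by (fastforce simp: mem_box_cart Delta_def)
  then have "bounded (Delta :: (real^'n) set)"
    using bounded_cbox bounded_subset by blast
  ultimately show ?thesis
    by (simp add: compact_eq_bounded_closed)
qed

lemma continuous_lin_ext: "continuous_on S (\<lambda>\<alpha>. lin_ext w \<alpha> p)"
  unfolding lin_ext_def by (intro continuous_intros)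

lemma Delta_nonempty: "Delta \<noteq> ({} :: (real^'n) set)"
proof -
  have "axis (undefined::'n) 1 \<in> (Delta :: (real^'n) set)"
    by (auto simp: Delta_def axis_def)
  then show ?thesis by blast
qed

lemma ubar_is_max:
  "\<exists>\<alpha>\<in>BR v p. ubar u v p = lin_ext u \<alpha> p \<and> (\<forall>\<alpha>'\<in>BR v p. lin_ext u \<alpha>' p \<le> lin_ext u \<alpha> p)"
proof -
  obtain \<alpha>0 where \<alpha>0: "\<alpha>0 \<in> Delta" "\<forall>\<alpha>'\<in>Delta. lin_ext v \<alpha>' p \<le> lin_ext v \<alpha>0 p"
    using continuous_attains_sup[OF compact_Delta Delta_nonempty continuous_lin_ext] by blast
  have "BR v p = Delta \<inter> {\<alpha>. lin_ext v \<alpha>0 p \<le> lin_ext v \<alpha> p}"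
    using \<alpha>0 by (force simp: BR_def)
  also have "compact \<dots>"
    by (intro compact_Int_closed compact_Delta closed_Collect_le continuous_lin_ext continuous_intros)
  finally have "compact (BR v p)" .
  moreover have "BR v p \<noteq> {}"
    using \<alpha>0 by (auto simp: BR_def)
  ultimately obtain \<alpha> where \<alpha>: "\<alpha> \<in> BR v p" "\<forall>\<alpha>'\<in>BR v p. lin_ext u \<alpha>' p \<le> lin_ext u \<alpha> p"
    using continuous_attains_sup[OF _ _ continuous_lin_ext] by metis
  then have "ubar u v p = lin_ext u \<alpha> p"
    unfolding ubar_def by (intro cSup_eq_maximum) auto
  with \<alpha> show ?thesis by blast
qed

lemma cav_least_concave_majorant:
  assumes bdd: "bdd_above (f ` (Delta :: (real^'n) set))"
  shows "concave_on Delta (cav f)"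
    and "\<forall>q\<in>Delta. f q \<le> cav f q"
    and "concave_on Delta g \<Longrightarrow> \<forall>q\<in>Delta. f q \<le> g q \<Longrightarrow> \<forall>q\<in>Delta. cav f q \<le> g q"
proof -
  let ?G = "{g. concave_on Delta g \<and> (\<forall>q\<in>Delta. f q \<le> g q)}"
  have cvx: "convex (Delta :: (real^'n) set)"
    by (auto simp: convex_def Delta_def sum.distrib simp flip: sum_distrib_left)
  obtain B where "\<forall>q\<in>Delta. f q \<le> B"
    using bdd by (auto simp: bdd_above_def)
  then have "(\<lambda>_. B) \<in> ?G"
    using cvx by (auto simp: concave_on_iff simp flip: distrib_right)
  then have ne: "?G \<noteq> {}" by blast
  have below: "bdd_below ((\<lambda>g. g q) ` ?G)" if "q \<in> Delta" for q
    using that by (intro bdd_belowI[of _ "f q"]) auto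
  show maj: "\<forall>q\<in>Delta. f q \<le> cav f q"
    unfolding cav_def using ne by (intro ballI cINF_greatest) auto
  show least: "\<forall>q\<in>Delta. cav f q \<le> g q" if "concave_on Delta g" "\<forall>q\<in>Delta. f q \<le> g q" for g
    unfolding cav_def using that below by (auto intro!: cINF_lower)
  show "concave_on Delta (cav f)"
    unfolding concave_on_iff
  proof (intro conjI cvx ballI allI impI)
    fix x y :: "real^'n" and s t :: real
    assume x: "x \<in> Delta" and y: "y \<in> Delta" and s: "0 \<le> s" and t: "0 \<le> t" and st: "s + t = 1"
    show "s * cav f x + t * cav f y \<le> cav f (s *\<^sub>R x + t *\<^sub>R y)"
      unfolding cav_def[of f "s *\<^sub>R x + t *\<^sub>R y"]
    proof (rule cINF_greatest[OF ne])
      fix g assume g: "g \<in> ?G"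
      then have "s * cav f x + t * cav f y \<le> s * g x + t * g y"
        using least x y s t by (intro add_mono mult_left_mono) auto
      also have "\<dots> \<le> g (s *\<^sub>R x + t *\<^sub>R y)"
        using g x y s t st by (auto simp: concave_on_iff)
      finally show "s * cav f x + t * cav f y \<le> g (s *\<^sub>R x + t *\<^sub>R y)" .
    qed
  qed
qed

lemma bdd_above_ubar: "bdd_above (ubar u v ` Delta)"
proof -
  have "ubar u v p \<le> (\<Sum>a\<in>UNIV. \<Sum>\<omega>\<in>UNIV. \<bar>u a \<omega>\<bar>)" if p: "p \<in> Delta" for p
  proof -
    obtain \<alpha> where \<alpha>: "\<alpha> \<in> BR v p" and eq: "ubar u v p = lin_ext u \<alpha> p"
      using ubar_is_max by blast
    have "\<alpha> $ a * p $ \<omega> * u a \<omega> \<le> \<bar>u a \<omega>\<bar>" for a \<omega>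
    proof -
      have "0 \<le> \<alpha> $ a" "\<alpha> $ a \<le> 1" "0 \<le> p $ \<omega>" "p $ \<omega> \<le> 1"
        using \<alpha> p Delta_le_1[of \<alpha>] Delta_le_1[of p] by (auto simp: BR_def Delta_def)
      then have "0 \<le> \<alpha> $ a * p $ \<omega>" "\<alpha> $ a * p $ \<omega> \<le> 1"
        by (auto intro: mult_le_one)
      then have "\<bar>\<alpha> $ a * p $ \<omega> * u a \<omega>\<bar> \<le> 1 * \<bar>u a \<omega>\<bar>"
        unfolding abs_mult[of "\<alpha> $ a * p $ \<omega>"] by (intro mult_right_mono) auto
      then show ?thesis by simp
    qed
    then show ?thesis
      unfolding eq lin_ext_def by (intro sum_mono)
  qed
  then show ?thesis by (auto intro!: bdd_aboveI)
qed

end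

theory Submission
  imports Defs
begin

text \<open>
  Let both experts run the experiment that splits the prior into the posteriors of an optimal
  splitting for the concavification. By optimality, on the segment between two of
  these posteriors no best reply gives expert 1 more than the linear interpolation of his on-path
  payoffs. Hence, after mismatched reports \<open>s\<close> and \<open>s'\<close>, some belief between the two posteriors
  has a best reply that gives \<open>u\<close> no more than the on-path payoff both at \<open>s\<close> and at \<open>s'\<close>.
  This deters both experts, since replies that are not optimal for \<open>v\<close> at the true posterior
  also lower the \<open>v\<close>-part of expert 2's payoff. After any other choice of experiments the experts
  babble; the resulting payoffs are at most those on path, as expert 1 gets at most the
  concavification and information is valuable to the decision-maker.
\<close>

section \<open>Best replies and optimal splittings\<close>

lemma convex_Delta: "convex (Delta :: (real^'n) set)"
  by (auto simp: convex_def Delta_def sum.distrib simp flip: sum_distrib_left)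

lemma BR_nonempty: "BR v p \<noteq> {}"
  using ubar_is_max by blast

lemma linear_lin_ext_left: "linear (\<lambda>\<alpha>. lin_ext w \<alpha> p)"
  by (rule linearI) (simp_all add: lin_ext_def sum.distrib sum_distrib_left algebra_simps)

lemma linear_lin_ext_right: "linear (lin_ext w \<alpha>)"
  by (rule linearI) (simp_all add: lin_ext_def sum.distrib sum_distrib_left algebra_simps)

lemma lin_ext_combination:
  "lin_ext (\<lambda>a \<omega>. b * u a \<omega> + c * v a \<omega>) \<alpha> p = b * lin_ext u \<alpha> p + c * lin_ext v \<alpha> p"
  by (simp add: lin_ext_def sum.distrib sum_distrib_left algebra_simps)

lemma lin_ext_state_sum: "lin_ext w \<alpha> p = (\<Sum>\<omega>\<in>UNIV. p $ \<omega> * (\<Sum>a\<in>UNIV. \<alpha> $ a * w a \<omega>))"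
  unfolding lin_ext_def by (subst sum.swap) (simp add: sum_distrib_left mult_ac)

text \<open>Needed to mix two best replies found at one belief: \<open>v\<close> is linear in the
  reply, so a mixture of two maximisers is again a maximiser.\<close>

lemma convex_BR: "convex (BR v p)"
proof (rule convexI)
  fix x y :: "real^'a" and s t :: real
  assume x: "x \<in> BR v p" and y: "y \<in> BR v p" and st: "0 \<le> s" "0 \<le> t" "s + t = 1"
  have "s *\<^sub>R x + t *\<^sub>R y \<in> Delta"
    using x y st convex_Delta by (auto simp: BR_def convex_def)
  moreover have "lin_ext v \<alpha> p \<le> lin_ext v (s *\<^sub>R x + t *\<^sub>R y) p" if "\<alpha> \<in> Delta" for \<alpha>
  proof -
    have "lin_ext v \<alpha> p = s * lin_ext v \<alpha> p + t * lin_ext v \<alpha> p"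
      using st by (simp flip: distrib_right)
    also have "\<dots> \<le> s * lin_ext v x p + t * lin_ext v y p"
      using x y st that by (intro add_mono mult_left_mono) (auto simp: BR_def)
    also have "\<dots> = lin_ext v (s *\<^sub>R x + t *\<^sub>R y) p"
      by (simp add: linear_add[OF linear_lin_ext_left] linear_scale[OF linear_lin_ext_left])
    finally show ?thesis .
  qed
  ultimately show "s *\<^sub>R x + t *\<^sub>R y \<in> BR v p"
    by (simp add: BR_def)
qed

lemma continuous_on_lin_ext [continuous_intros]:
  assumes "continuous_on S f" "continuous_on S g"
  shows "continuous_on S (\<lambda>x. lin_ext w (f x) (g x))"
  unfolding lin_ext_def using assms by (intro continuous_intros)

text \<open>The graph is cut out of a compact product by one closed inequality for each alternative
  reply. Its compactness is what lets the concavification be attained by a finite splitting.\<close>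

lemma compact_BR_graph: "compact {(p, \<alpha>). p \<in> Delta \<and> \<alpha> \<in> BR v p}"
proof -
  have "{(p, \<alpha>). p \<in> Delta \<and> \<alpha> \<in> BR v p} =
      (Delta \<times> Delta) \<inter> (\<Inter>\<alpha>'\<in>Delta. {x. lin_ext v \<alpha>' (fst x) \<le> lin_ext v (snd x) (fst x)})"
    by (auto simp: BR_def)
  also have "compact \<dots>"
    by (intro compact_Int_closed compact_Times compact_Delta closed_INT ballI closed_Collect_le
        continuous_intros)
  finally show ?thesis .
qed

lemma lin_ext_le_cav:
  assumes "p \<in> Delta" "\<alpha> \<in> BR v p"
  shows "lin_ext u \<alpha> p \<le> cav (ubar u v) p"
  using cav_least_concave_majorant(2)[OF bdd_above_ubar] ubar_is_max assms by (metis order_trans)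

text \<open>
  On the segment from \<open>q1\<close> to \<open>q0\<close> the two closed conditions \<open>u(\<alpha>, q0) \<le> y0\<close> and
  \<open>u(\<alpha>, q1) \<le> y1\<close> cover all best replies, and each is met at one endpoint, so by connectedness
  both occur at a common belief; a convex combination of the two best replies found there
  satisfies both.
\<close>

lemma common_punishment:
  fixes q0 q1 :: "real^'w::finite" and u v :: "'a::finite \<Rightarrow> 'w \<Rightarrow> real"
  assumes q0: "q0 \<in> Delta" and q1: "q1 \<in> Delta"
    and bound: "\<And>t \<alpha>. 0 \<le> t \<Longrightarrow> t \<le> 1 \<Longrightarrow> \<alpha> \<in> BR v (t *\<^sub>R q0 + (1 - t) *\<^sub>R q1) \<Longrightarrow>
      t * lin_ext u \<alpha> q0 + (1 - t) * lin_ext u \<alpha> q1 \<le> t * y0 + (1 - t) * y1"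
  shows "\<exists>z\<in>closed_segment q0 q1. \<exists>\<alpha>\<in>BR v z. lin_ext u \<alpha> q0 \<le> y0 \<and> lin_ext u \<alpha> q1 \<le> y1"
proof -
  define z where "z t = t *\<^sub>R q0 + (1 - t) *\<^sub>R q1" for t :: real
  have z_segment: "z t \<in> closed_segment q0 q1" if "t \<in> {0..1}" for t
    using that unfolding closed_segment_commute[of q0]
    by (auto simp: z_def closed_segment_def add.commute intro!: exI[of _ t])
  have z_Delta: "z t \<in> Delta" if "t \<in> {0..1}" for t
    using that convexD[OF convex_Delta q0 q1, of t "1 - t"] by (auto simp: z_def)
  \<comment> \<open>Best replies along the whole segment. Compactness of \<open>K\<close> makes the
    projections \<open>F0\<close> and \<open>F1\<close> closed.\<close>
  define K where "K = {(t, \<alpha>). t \<in> {0..1} \<and> \<alpha> \<in> BR v (z t)}"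
  have "K = ({0..1} \<times> Delta) \<inter> (\<Inter>\<alpha>'\<in>Delta. {x. lin_ext v \<alpha>' (z (fst x)) \<le> lin_ext v (snd x) (z (fst x))})"
    by (auto simp: K_def BR_def)
  also have "compact \<dots>" unfolding z_def
    by (intro compact_Int_closed compact_Times compact_Icc compact_Delta closed_INT ballI closed_Collect_le
        continuous_intros)
  finally have compact_K: "compact K" .
  define F0 where "F0 = fst ` (K \<inter> {x. lin_ext u (snd x) q0 \<le> y0})"
  define F1 where "F1 = fst ` (K \<inter> {x. lin_ext u (snd x) q1 \<le> y1})"
  have closed: "closed F0" "closed F1"
    unfolding F0_def F1_def
    by (intro compact_imp_closed compact_continuous_image compact_Int_closed compact_K
        closed_Collect_le continuous_intros)+
  \<comment> \<open>Two strict excesses, averaged with weights \<open>t\<close> and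
    \<open>1 - t\<close> that do not both vanish, would violate \<open>bound\<close>.\<close>
  have alt: "lin_ext u \<alpha> q0 \<le> y0 \<or> lin_ext u \<alpha> q1 \<le> y1" if "t \<in> {0..1}" "\<alpha> \<in> BR v (z t)" for t \<alpha>
  proof (rule ccontr)
    assume "\<not> ?thesis"
    then have "lin_ext u \<alpha> q0 > y0" "lin_ext u \<alpha> q1 > y1" by auto
    moreover have "t * (lin_ext u \<alpha> q0 - y0) + (1 - t) * (lin_ext u \<alpha> q1 - y1) \<le> 0"
      using bound[of t \<alpha>] that by (auto simp: z_def algebra_simps)
    moreover have "t > 0 \<or> 1 - t > 0" by linarith
    ultimately show False
      using that by (smt (verit, best) atLeastAtMost_iff mult_nonneg_nonneg mult_pos_pos)
  qed
  have cover: "{0..1} \<subseteq> F0 \<union> F1"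
  proof
    fix t :: real assume t: "t \<in> {0..1}"
    obtain \<alpha> where "\<alpha> \<in> BR v (z t)" using BR_nonempty by blast
    with t alt[OF t this] show "t \<in> F0 \<union> F1"
      unfolding F0_def F1_def K_def by force
  qed
  have end0: "lin_ext u \<alpha> q0 \<le> y0" if "\<alpha> \<in> BR v (z 1)" for \<alpha>
    using bound[of 1 \<alpha>] that by (simp add: z_def)
  have end1: "lin_ext u \<alpha> q1 \<le> y1" if "\<alpha> \<in> BR v (z 0)" for \<alpha>
    using bound[of 0 \<alpha>] that by (simp add: z_def)
  obtain a0 where a0: "a0 \<in> BR v (z 1)" using BR_nonempty by blast
  have "1 \<in> F0"
    unfolding F0_def K_def using a0 end0 by force
  moreover obtain a1 where a1: "a1 \<in> BR v (z 0)" using BR_nonempty by blast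
  have "0 \<in> F1"
    unfolding F1_def K_def using a1 end1 by force
  ultimately obtain t where t: "t \<in> {0..1}" "t \<in> F0" "t \<in> F1"
    using connected_closedD[OF connected_Icc[of 0 1] _ cover closed] by fastforce
  then obtain b0 b1 where b0: "b0 \<in> BR v (z t)" "lin_ext u b0 q0 \<le> y0"
    and b1: "b1 \<in> BR v (z t)" "lin_ext u b1 q1 \<le> y1"
    unfolding F0_def F1_def K_def by auto
  have "\<exists>\<alpha>\<in>BR v (z t). lin_ext u \<alpha> q0 \<le> y0 \<and> lin_ext u \<alpha> q1 \<le> y1"
  \<comment> \<open>At \<open>t = 1\<close> the belief is \<open>q0\<close>, where
    \<open>end0\<close> holds for every best reply, so \<open>b1\<close> serves. Excluding this
    value also makes \<open>1 - t\<close> positive for the final division.\<close>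
  proof (cases "t = 1 \<or> lin_ext u b1 q0 \<le> y0")
    case True
    then show ?thesis using b1 end0 by auto
  next
    case False
    define d where "d = lin_ext u b1 q0 - lin_ext u b0 q0"
    \<comment> \<open>The weight at which the mixture gives exactly \<open>y0\<close> at
      \<open>q0\<close>; \<open>bound\<close> then reduces to the inequality at
      \<open>q1\<close>.\<close>
    define r where "r = (y0 - lin_ext u b0 q0) / d"
    have d: "d > 0" using False b0 by (simp add: d_def)
    have r: "0 \<le> r" "r \<le> 1" using False b0 d by (simp_all add: r_def d_def)
    define b where "b = (1 - r) *\<^sub>R b0 + r *\<^sub>R b1"
    have b: "b \<in> BR v (z t)"
      unfolding b_def using convexD[OF convex_BR b0(1) b1(1)] r by auto
    have "lin_ext u b q0 = (1 - r) * lin_ext u b0 q0 + r * lin_ext u b1 q0"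
      unfolding b_def
      by (simp only: linear_add[OF linear_lin_ext_left] linear_scale[OF linear_lin_ext_left] real_scaleR_def)
    also have "\<dots> = lin_ext u b0 q0 + r * d"
      by (simp add: d_def algebra_simps)
    also have "\<dots> = y0" using d by (simp add: r_def)
    finally have eq: "lin_ext u b q0 = y0" .
    have "(1 - t) * lin_ext u b q1 \<le> (1 - t) * y1"
      using bound[of t b] t b by (simp add: z_def eq)
    then have "lin_ext u b q1 \<le> y1" using False t by simp
    with b eq show ?thesis by auto
  qed
  with z_segment t show ?thesis by blast
qed

text \<open>The concavification at the prior is the top height of a convex hull, hence reached by a
  finite convex combination of points (belief, payoff); these points form the index set. The last
  property is the optimality used against mismatched reports: a better best reply between two of the
  beliefs would permit a better splitting.\<close>

lemma optimal_splitting: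
  fixes prior :: "real^'w::finite" and u v :: "'a::finite \<Rightarrow> 'w \<Rightarrow> real"
  assumes prior: "prior \<in> Delta"
  obtains I :: "((real^'w) \<times> real) set" and c q a where
    "finite I" "I \<noteq> {}" "\<And>i. i \<in> I \<Longrightarrow> 0 < c i" "sum c I = 1"
    "\<And>i. i \<in> I \<Longrightarrow> q i \<in> Delta" "(\<Sum>i\<in>I. c i *\<^sub>R q i) = prior"
    "\<And>i. i \<in> I \<Longrightarrow> a i \<in> BR v (q i)"
    "(\<Sum>i\<in>I. c i * lin_ext u (a i) (q i)) = cav (ubar u v) prior"
    "\<And>i j t b. i \<in> I \<Longrightarrow> j \<in> I \<Longrightarrow> 0 \<le> t \<Longrightarrow> t \<le> 1 \<Longrightarrow> b \<in> BR v (t *\<^sub>R q i + (1 - t) *\<^sub>R q j) \<Longrightarrow>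
       lin_ext u b (t *\<^sub>R q i + (1 - t) *\<^sub>R q j) \<le>
         t * lin_ext u (a i) (q i) + (1 - t) * lin_ext u (a j) (q j)"
proof -
  \<comment> \<open>The concavification is the upper boundary of the convex hull of the compact set \<open>H\<close>.\<close>
  define H where "H = (\<lambda>(p, \<alpha>). (p, lin_ext u \<alpha> p)) ` {(p, \<alpha>). p \<in> Delta \<and> \<alpha> \<in> BR v p}"
  have H_I: "(p, lin_ext u \<alpha> p) \<in> H" if "p \<in> Delta" "\<alpha> \<in> BR v p" for p \<alpha>
    using that by (auto simp: H_def)
  have "compact H"
    unfolding H_def case_prod_beta'
    by (intro compact_continuous_image continuous_intros compact_BR_graph[unfolded case_prod_beta'])
  then have compact_hull: "compact (convex hull H)" by (rule compact_convex_hull)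
  \<comment> \<open>Height of the hull above \<open>p\<close>; compactness makes the supremum
    attained.\<close>
  define G where "G p = Sup {y. (p, y) \<in> convex hull H}" for p
  have G: "(p, G p) \<in> convex hull H" "\<And>y. (p, y) \<in> convex hull H \<Longrightarrow> y \<le> G p" if p: "p \<in> Delta" for p
  proof -
    let ?Y = "snd ` (convex hull H \<inter> {x. fst x = p})"
    have "compact ?Y"
      by (intro compact_continuous_image continuous_intros compact_Int_closed compact_hull closed_Collect_eq)
    moreover have Y: "?Y = {y. (p, y) \<in> convex hull H}" by force
    moreover obtain \<alpha> where "\<alpha> \<in> BR v p" using BR_nonempty by blast
    then have "lin_ext u \<alpha> p \<in> {y. (p, y) \<in> convex hull H}"
      using H_I p hull_inc by fastforce
    then have "{y. (p, y) \<in> convex hull H} \<noteq> {}" by blast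
    ultimately have c: "compact {y. (p, y) \<in> convex hull H}" and n: "{y. (p, y) \<in> convex hull H} \<noteq> {}" by auto
    from closed_contains_Sup[OF n bounded_imp_bdd_above[OF compact_imp_bounded[OF c]] compact_imp_closed[OF c]]
    show "(p, G p) \<in> convex hull H" by (simp add: G_def)
    show "y \<le> G p" if "(p, y) \<in> convex hull H" for y
      unfolding G_def using that by (intro cSup_upper bounded_imp_bdd_above compact_imp_bounded c) auto
  qed
  obtain S c0 where S: "finite S" "S \<subseteq> H" "\<And>x. x \<in> S \<Longrightarrow> 0 \<le> c0 x" "sum c0 S = 1"
    "(\<Sum>x\<in>S. c0 x *\<^sub>R x) = (prior, G prior)"
    using G(1)[OF prior] unfolding convex_hull_explicit by auto
  \<comment> \<open>Zero weights are dropped: shifting mass in \<open>exchange\<close> divides by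
    \<open>c0\<close>, and every signal is to have positive probability.\<close>
  define I where "I = {x\<in>S. 0 < c0 x}"
  have I: "finite I" "I \<subseteq> H" and c_pos: "\<And>x. x \<in> I \<Longrightarrow> 0 < c0 x"
    using S by (auto simp: I_def)
  have zero: "c0 x = 0" if "x \<in> S - I" for x
    using that S(3)[of x] by (auto simp: I_def)
  have sum_c: "sum c0 I = 1"
    unfolding S(4)[symmetric] using S(1) zero by (intro sum.mono_neutral_left) (auto simp: I_def)
  then have I_ne: "I \<noteq> {}" by auto
  have sum_x: "(\<Sum>x\<in>I. c0 x *\<^sub>R x) = (prior, G prior)"
    unfolding S(5)[symmetric] using S(1) zero by (intro sum.mono_neutral_left) (auto simp: I_def)
  have "\<forall>x\<in>I. \<exists>\<alpha>. fst x \<in> Delta \<and> \<alpha> \<in> BR v (fst x) \<and> snd x = lin_ext u \<alpha> (fst x)"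
  proof
    fix x assume "x \<in> I"
    then have "x \<in> H" using I(2) by blast
    then show "\<exists>\<alpha>. fst x \<in> Delta \<and> \<alpha> \<in> BR v (fst x) \<and> snd x = lin_ext u \<alpha> (fst x)"
      unfolding H_def by auto
  qed
  then obtain a where a: "\<And>x. x \<in> I \<Longrightarrow> fst x \<in> Delta" "\<And>x. x \<in> I \<Longrightarrow> a x \<in> BR v (fst x)"
    "\<And>x. x \<in> I \<Longrightarrow> snd x = lin_ext u (a x) (fst x)"
    by metis
  have sum_q: "(\<Sum>x\<in>I. c0 x *\<^sub>R fst x) = prior"
    using arg_cong[OF sum_x, of fst] by (simp add: fst_sum)
  have sum_y: "(\<Sum>x\<in>I. c0 x * snd x) = G prior"
    using arg_cong[OF sum_x, of snd] by (simp add: snd_sum)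
  \<comment> \<open>\<open>G\<close> is a concave majorant of \<open>ubar u v\<close>, hence above
    the concavification; Jensen's inequality on the splitting gives the converse at the
    prior.\<close>
  have "concave_on Delta G"
    unfolding concave_on_iff
  proof (intro conjI convex_Delta ballI allI impI)
    fix x y :: "real^'w" and s t :: real
    assume x: "x \<in> Delta" and y: "y \<in> Delta" and st: "0 \<le> s" "0 \<le> t" "s + t = 1"
    have "s *\<^sub>R (x, G x) + t *\<^sub>R (y, G y) \<in> convex hull H"
      using st by (intro convexD[OF convex_convex_hull] G x y)
    then show "s * G x + t * G y \<le> G (s *\<^sub>R x + t *\<^sub>R y)"
      using st by (intro G convexD[OF convex_Delta x y]) auto
  qed
  moreover have "\<forall>p\<in>Delta. ubar u v p \<le> G p"
  proof
    fix p :: "real^'w" assume p: "p \<in> Delta"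
    obtain \<alpha> where "\<alpha> \<in> BR v p" "ubar u v p = lin_ext u \<alpha> p" using ubar_is_max by blast
    then show "ubar u v p \<le> G p"
      using G(2)[OF p] H_I[OF p] hull_inc by metis
  qed
  ultimately have "cav (ubar u v) prior \<le> G prior"
    using cav_least_concave_majorant(3)[OF bdd_above_ubar] prior by blast
  moreover have "G prior \<le> cav (ubar u v) prior"
  proof -
    have "G prior \<le> (\<Sum>x\<in>I. c0 x * cav (ubar u v) (fst x))"
      unfolding sum_y[symmetric] using a(3) lin_ext_le_cav[OF a(1,2)] c_pos
      by (intro sum_mono mult_left_mono) (auto simp: less_imp_le)
    also have "\<dots> \<le> cav (ubar u v) (\<Sum>x\<in>I. c0 x *\<^sub>R fst x)"
      using I I_ne sum_c c_pos a
      by (intro concave_on_sum[where C = Delta] cav_least_concave_majorant(1) bdd_above_ubar)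
        (auto simp: less_imp_le)
    finally show ?thesis by (simp add: sum_q)
  qed
  ultimately have G_eq: "G prior = cav (ubar u v) prior" by simp
  \<comment> \<open>Moving a little mass from \<open>i\<close> and \<open>j\<close> to a point on their segment cannot raise the value.\<close>
  have exchange: "x \<le> t * snd i + (1 - t) * snd j"
    if i: "i \<in> I" and j: "j \<in> I" and t: "0 \<le> t" "t \<le> 1" and x: "(t *\<^sub>R fst i + (1 - t) *\<^sub>R fst j, x) \<in> H"
    for i j t x
  proof -
    define z where "z = t *\<^sub>R fst i + (1 - t) *\<^sub>R fst j"
    \<comment> \<open>Small enough that neither point loses more mass than it has, even if
      \<open>i = j\<close>, when \<open>w i = 1\<close>.\<close>
    define e where "e = min (c0 i) (c0 j)"
    have e: "0 < e" using c_pos i j by (simp add: e_def)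
    define w where "w k = (if k = i then t else 0) + (if k = j then 1 - t else 0)" for k
    have w: "0 \<le> w k" "e * w k \<le> c0 k" if "k \<in> I" for k
    proof -
      show "0 \<le> w k" using t by (simp add: w_def)
      have "e * w k \<le> e" using t e by (simp add: w_def)
      then show "e * w k \<le> c0 k"
        using c_pos[OF that] by (auto simp: w_def e_def split: if_splits)
    qed
    \<comment> \<open>Point \<open>k\<close> hands the share \<open>e * w k / c0 k\<close> of its
      mass to \<open>(z, x)\<close>. The barycentre stays above the prior because \<open>z\<close>
      is the same combination of \<open>fst i\<close> and \<open>fst j\<close>, so only the height
      changes.\<close>
    define g where "g k = (1 - e * w k / c0 k) *\<^sub>R k + (e * w k / c0 k) *\<^sub>R (z, x)" for k
    have "g k \<in> convex hull H" if "k \<in> I" for k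
      unfolding g_def using I that x w[OF that] c_pos[OF that] e
      by (intro convexD[OF convex_convex_hull] hull_inc) (auto simp: z_def)
    then have "(\<Sum>k\<in>I. c0 k *\<^sub>R g k) \<in> convex hull H"
      using sum_c c_pos I by (intro convex_sum) (auto simp: less_imp_le)
    also have "(\<Sum>k\<in>I. c0 k *\<^sub>R g k) = (\<Sum>k\<in>I. c0 k *\<^sub>R k) + (\<Sum>k\<in>I. e *\<^sub>R w k *\<^sub>R ((z, x) - k))"
      unfolding sum.distrib[symmetric]
    proof (rule sum.cong[OF refl])
      fix k assume "k \<in> I"
      then have "c0 k \<noteq> 0" using c_pos[of k] by auto
      then have coeffs: "c0 k * (1 - e * w k / c0 k) = c0 k - e * w k" "c0 k * (e * w k / c0 k) = e * w k"
        by (simp_all add: right_diff_distrib)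
      show "c0 k *\<^sub>R g k = c0 k *\<^sub>R k + e *\<^sub>R w k *\<^sub>R ((z, x) - k)"
        unfolding g_def scaleR_add_right scaleR_scaleR coeffs scaleR_diff_left scaleR_diff_right by simp
    qed
    also have "(\<Sum>k\<in>I. e *\<^sub>R w k *\<^sub>R ((z, x) - k)) = e *\<^sub>R (t *\<^sub>R ((z, x) - i) + (1 - t) *\<^sub>R ((z, x) - j))"
    proof -
      have "(\<Sum>k\<in>I. w k *\<^sub>R ((z, x) - k)) =
          (\<Sum>k\<in>I. if k = i then t *\<^sub>R ((z, x) - k) else 0) + (\<Sum>k\<in>I. if k = j then (1 - t) *\<^sub>R ((z, x) - k) else 0)"
        unfolding sum.distrib[symmetric] by (rule sum.cong) (auto simp: w_def scaleR_add_left)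
      also have "\<dots> = t *\<^sub>R ((z, x) - i) + (1 - t) *\<^sub>R ((z, x) - j)"
        using I i j by (simp add: sum.delta)
      finally show ?thesis by (simp only: scaleR_sum_right[symmetric])
    qed
    also have "(\<Sum>k\<in>I. c0 k *\<^sub>R k) + e *\<^sub>R (t *\<^sub>R ((z, x) - i) + (1 - t) *\<^sub>R ((z, x) - j)) =
      (prior, G prior + e * (x - (t * snd i + (1 - t) * snd j)))"
      unfolding sum_x by (cases i, cases j) (simp add: z_def algebra_simps)
    finally have "e * (x - (t * snd i + (1 - t) * snd j)) \<le> 0"
      using G(2)[OF prior] by fastforce
    then show ?thesis using e by (simp add: mult_le_0_iff)
  qed
  show thesis
  proof (rule that[of I c0 fst a])
    show "(\<Sum>i\<in>I. c0 i * lin_ext u (a i) (fst i)) = cav (ubar u v) prior"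
      unfolding G_eq[symmetric] sum_y[symmetric] using a(3) by simp
    fix i j t b
    assume ij: "i \<in> I" "j \<in> I" and t: "0 \<le> t" "t \<le> 1" and b: "b \<in> BR v (t *\<^sub>R fst i + (1 - t) *\<^sub>R fst j)"
    have "t *\<^sub>R fst i + (1 - t) *\<^sub>R fst j \<in> Delta"
      using ij t a by (intro convexD[OF convex_Delta]) auto
    from exchange[OF ij t H_I[OF this b]]
    show "lin_ext u b (t *\<^sub>R fst i + (1 - t) *\<^sub>R fst j) \<le>
         t * lin_ext u (a i) (fst i) + (1 - t) * lin_ext u (a j) (fst j)"
      using ij a by simp
  qed (use I I_ne c_pos sum_c a sum_q in auto)
qed


section \<open>Experiments\<close>

lemma experiment_slice_sets:
  assumes "is_experiment \<sigma>" "s \<in> \<sigma>"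
  shows "{x. (\<omega>, x) \<in> s} \<in> sets lebesgue"
proof -
  have "Pair \<omega> -` s \<in> sets lebesgue"
    using assms by (intro sets_Pair1) (auto simp: is_experiment_def)
  then show ?thesis by (simp add: vimage_def)
qed

lemma experiment_subset: "is_experiment \<sigma> \<Longrightarrow> s \<in> \<sigma> \<Longrightarrow> s \<subseteq> UNIV \<times> {0..1}"
  by (auto simp: is_experiment_def dest: partition_onD1)

lemma experiment_nonempty: "is_experiment \<sigma> \<Longrightarrow> \<sigma> \<noteq> {}"
  by (fastforce simp: is_experiment_def partition_on_def)

lemma experiment_disjoint:
  "is_experiment \<sigma> \<Longrightarrow> s \<in> \<sigma> \<Longrightarrow> s' \<in> \<sigma> \<Longrightarrow> s \<noteq> s' \<Longrightarrow> s \<inter> s' = {}"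
  by (auto simp: is_experiment_def partition_on_def disjoint_def)

section \<open>Probabilities of states, events and signal pairs\<close>

lemma state_prob_nonneg: "p \<in> Delta \<Longrightarrow> 0 \<le> state_prob p E \<omega>"
  by (simp add: state_prob_def Delta_def)

lemma event_prob_nonneg: "p \<in> Delta \<Longrightarrow> 0 \<le> event_prob p E"
  by (simp add: event_prob_def sum_nonneg state_prob_nonneg)

lemma state_prob_empty [simp]: "state_prob p {} \<omega> = 0"
  by (simp add: state_prob_def)

text \<open>Also true for a null event, whose posterior is a division by zero: nonnegative summands
  with sum zero all vanish. Sums over signals thus need no case distinction.\<close>

lemma state_prob_eq_posterior:
  assumes "p \<in> Delta"
  shows "state_prob p E \<omega> = event_prob p E * posterior p E $ \<omega>"
proof (cases "event_prob p E = 0")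
  case True
  then have "state_prob p E \<omega> = 0"
    unfolding event_prob_def by (subst (asm) sum_nonneg_eq_0_iff) (auto simp: state_prob_nonneg assms)
  with True show ?thesis by simp
qed (simp add: posterior_def)

lemma posterior_Delta:
  assumes "p \<in> Delta" "0 < event_prob p E"
  shows "posterior p E \<in> Delta"
  using assms
  by (auto simp: Delta_def posterior_def state_prob_nonneg event_prob_def simp flip: sum_divide_distrib
      intro!: divide_nonneg_nonneg sum_nonneg)

text \<open>Total probability: at state \<open>\<omega>\<close> the cells cut \<open>E\<close> into
  disjoint slices, which are bounded and so of finite measure, and Lebesgue measure is additive on
  them.\<close>

lemma sum_state_prob_experiment:
  assumes \<sigma>: "is_experiment \<sigma>" and E: "E \<subseteq> UNIV \<times> {0..1}" "{x. (\<omega>, x) \<in> E} \<in> sets lebesgue"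
  shows "(\<Sum>s\<in>\<sigma>. state_prob p (E \<inter> s) \<omega>) = state_prob p E \<omega>"
proof -
  define A where "A s = {x. (\<omega>, x) \<in> E \<inter> s}" for s
  have A_eq: "A s = {x. (\<omega>, x) \<in> E} \<inter> {x. (\<omega>, x) \<in> s}" for s
    by (auto simp: A_def)
  have "A s \<in> lmeasurable" if "s \<in> \<sigma>" for s
  proof (rule bounded_set_imp_lmeasurable)
    show "A s \<in> sets lebesgue"
      unfolding A_eq using that \<sigma> E experiment_slice_sets by blast
    show "bounded (A s)"
      by (rule bounded_subset[of "{0..1}"]) (use E in \<open>auto simp: A_def\<close>)
  qed
  moreover have "pairwise (\<lambda>s s'. negligible (A s \<inter> A s')) \<sigma>"
  proof (rule pairwiseI)
    fix s s' assume "s \<in> \<sigma>" "s' \<in> \<sigma>" "s \<noteq> s'"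
    then have "A s \<inter> A s' = {}"
      using experiment_disjoint[OF \<sigma>] by (auto simp: A_def)
    then show "negligible (A s \<inter> A s')" by simp
  qed
  moreover have "finite \<sigma>" using \<sigma> by (simp add: is_experiment_def)
  ultimately have "measure lebesgue (\<Union>(A ` \<sigma>)) = (\<Sum>s\<in>\<sigma>. measure lebesgue (A s))"
    by (intro measure_negligible_finite_Union_image)
  moreover have "\<Union>(A ` \<sigma>) = {x. (\<omega>, x) \<in> E}"
    using E \<sigma> by (auto simp: A_def is_experiment_def partition_on_def)
  ultimately show ?thesis
    by (simp add: state_prob_def A_def flip: sum_distrib_left)
qed

lemma sum_state_prob_single:
  assumes \<sigma>: "is_experiment \<sigma>"
  shows "(\<Sum>s\<in>\<sigma>. state_prob p s \<omega>) = p $ \<omega>"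
proof -
  have "(\<Sum>s\<in>\<sigma>. state_prob p (UNIV \<times> {0..1} \<inter> s) \<omega>) = state_prob p (UNIV \<times> {0..1}) \<omega>"
    by (rule sum_state_prob_experiment[OF \<sigma>]) auto
  moreover have "UNIV \<times> {0..1} \<inter> s = s" if "s \<in> \<sigma>" for s
    using experiment_subset[OF \<sigma> that] by blast
  moreover have "state_prob p (UNIV \<times> {0..1}) \<omega> = p $ \<omega>"
    using content_real[of 0 1] by (simp add: state_prob_def atLeastAtMost_def atLeast_def atMost_def Int_def)
  ultimately show ?thesis by simp
qed

lemma sum_state_prob_pair:
  assumes "is_experiment \<sigma>1" "is_experiment \<sigma>2"
  shows "(\<Sum>s1\<in>\<sigma>1. \<Sum>s2\<in>\<sigma>2. state_prob p (s1 \<inter> s2) \<omega>) = p $ \<omega>"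
  using assms sum_state_prob_single[of \<sigma>1 p \<omega>]
  by (simp add: sum_state_prob_experiment experiment_subset experiment_slice_sets)

text \<open>When both experts run the same experiment, distinct signals are disjoint and only the
  diagonal survives; \<open>f\<close> carries the message probabilities or payoffs attached to the
  other signal.\<close>

lemma sum_state_prob_same:
  assumes \<sigma>: "is_experiment \<sigma>" and s: "s \<in> \<sigma>"
  shows "(\<Sum>s'\<in>\<sigma>. state_prob p (s \<inter> s') \<omega> * f s') = state_prob p s \<omega> * f s"
proof -
  have "state_prob p (s \<inter> s') \<omega> = 0" if "s' \<in> \<sigma> - {s}" for s'
    using that experiment_disjoint[OF \<sigma> s, of s'] by force
  then have "(\<Sum>s'\<in>\<sigma>. state_prob p (s \<inter> s') \<omega> * f s') = (\<Sum>s'\<in>{s}. state_prob p (s \<inter> s') \<omega> * f s')"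
    using \<sigma> s by (intro sum.mono_neutral_right) (auto simp: is_experiment_def)
  then show ?thesis by simp
qed

section \<open>Realising a splitting by an experiment\<close>

lemma interval_partition:
  fixes k :: "'i \<Rightarrow> real"
  assumes "finite I" "I \<noteq> {}" "\<And>i. i \<in> I \<Longrightarrow> 0 \<le> k i"
  shows "\<exists>J. disjoint_family_on J I \<and> (\<Union>i\<in>I. J i) = {0..sum k I} \<and>
    (\<forall>i\<in>I. J i \<in> sets lebesgue \<and> measure lebesgue (J i) = k i)"
  using assms
proof (induction I rule: finite_ne_induct)
  case (singleton i)
  then show ?case by (intro exI[of _ "\<lambda>_. {0..k i}"]) (auto simp: disjoint_family_on_def)
next
  case (insert i I)
  then obtain J where J: "disjoint_family_on J I" "(\<Union>i\<in>I. J i) = {0..sum k I}"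
    "\<forall>i\<in>I. J i \<in> sets lebesgue \<and> measure lebesgue (J i) = k i"
    by auto
  \<comment> \<open>Open on the left because the earlier pieces already contain
    \<open>sum k I\<close>; the new piece is empty when \<open>k i = 0\<close>.\<close>
  define J' where "J' = J(i := {sum k I<..sum k I + k i})"
  have same: "J' j = J j" if "j \<in> I" for j
    using that insert by (auto simp: J'_def)
  have new: "J' i = {sum k I<..sum k I + k i}" by (simp add: J'_def)
  have pos: "0 \<le> k i" "0 \<le> sum k I" using insert by (auto intro: sum_nonneg)
  have U: "(\<Union>j\<in>I. J' j) = {0..sum k I}" using J(2) same by simp
  have "disjoint_family_on J' I" using J(1) same by (simp add: disjoint_family_on_def)
  then have "disjoint_family_on J' (insert i I)"
    using insert U unfolding disjoint_family_on_insert[OF \<open>i \<notin> I\<close>] by (auto simp: new)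
  moreover have "(\<Union>j\<in>insert i I. J' j) = {0..sum k (insert i I)}"
  proof -
    have "(\<Union>j\<in>insert i I. J' j) = {0..sum k I} \<union> {sum k I<..sum k I + k i}"
      by (simp add: U new Un_commute)
    also have "\<dots> = {0..sum k I + k i}" using pos by auto
    finally show ?thesis using insert by (simp add: add.commute)
  qed
  moreover have "\<forall>j\<in>insert i I. J' j \<in> sets lebesgue \<and> measure lebesgue (J' j) = k j"
    using J(3) same new pos by auto
  ultimately show ?case by blast
qed

text \<open>In a state \<open>\<omega>\<close> of positive prior probability, cell \<open>i\<close>
  gets the share \<open>c i * q i $ \<omega> / p $ \<omega>\<close> of the unit interval, so that
  state and cell have joint probability \<open>c i * q i $ \<omega>\<close>; Bayes' rule then
  returns \<open>q i\<close>.\<close>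

lemma experiment_of_splitting:
  fixes p :: "real^'w::finite" and c :: "'i \<Rightarrow> real"
  assumes p: "p \<in> Delta" and I: "finite I" "I \<noteq> {}" and c: "\<And>i. i \<in> I \<Longrightarrow> 0 < c i" "sum c I = 1"
    and q: "\<And>i. i \<in> I \<Longrightarrow> q i \<in> Delta" and split: "(\<Sum>i\<in>I. c i *\<^sub>R q i) = p"
  obtains cell where "inj_on cell I" "is_experiment (cell ` I)"
    "\<And>i. i \<in> I \<Longrightarrow> event_prob p (cell i) = c i" "\<And>i. i \<in> I \<Longrightarrow> posterior p (cell i) = q i"
proof -
  \<comment> \<open>The slice of a null state must be partitioned as well; any shares with sum 1
    would do there, and \<open>c\<close> supplies them.\<close>
  define k where "k \<omega> i = (if p $ \<omega> = 0 then c i else c i * q i $ \<omega> / p $ \<omega>)" for \<omega> i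
  have q_nonneg: "0 \<le> q i $ \<omega>" if "i \<in> I" for i \<omega> using q[OF that] by (simp add: Delta_def)
  have split_comp: "(\<Sum>i\<in>I. c i * q i $ \<omega>) = p $ \<omega>" for \<omega>
    using arg_cong[OF split, of "\<lambda>x. x $ \<omega>"] by simp
  have k_nonneg: "0 \<le> k \<omega> i" if "i \<in> I" for \<omega> i
    using that p c q_nonneg by (auto simp: k_def Delta_def less_imp_le)
  have k_sum: "sum (k \<omega>) I = 1" for \<omega>
    by (cases "p $ \<omega> = 0") (simp_all add: k_def c split_comp flip: sum_divide_distrib)
  \<comment> \<open>In a null state the right side vanishes too, as these nonnegative terms sum to
    \<open>p $ \<omega>\<close>.\<close>
  have k_prod: "p $ \<omega> * k \<omega> i = c i * q i $ \<omega>" if "i \<in> I" for \<omega> i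
  proof (cases "p $ \<omega> = 0")
    case True
    then have "(\<Sum>i\<in>I. c i * q i $ \<omega>) = 0" using split_comp[of \<omega>] by simp
    then have "c i * q i $ \<omega> = 0"
      using I(1) c(1) q_nonneg that
      by (subst (asm) sum_nonneg_eq_0_iff) (auto simp: less_imp_le)
    with True show ?thesis by simp
  qed (simp add: k_def)
  have "\<forall>\<omega>. \<exists>J :: 'i \<Rightarrow> real set. disjoint_family_on J I \<and> (\<Union>i\<in>I. J i) = {0..1} \<and>
    (\<forall>i\<in>I. J i \<in> sets lebesgue \<and> measure lebesgue (J i) = k \<omega> i)"
  proof
    fix \<omega>
    show "\<exists>J :: 'i \<Rightarrow> real set. disjoint_family_on J I \<and> (\<Union>i\<in>I. J i) = {0..1} \<and>
      (\<forall>i\<in>I. J i \<in> sets lebesgue \<and> measure lebesgue (J i) = k \<omega> i)"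
      using interval_partition[OF I, of "k \<omega>"] k_nonneg[of _ \<omega>] unfolding k_sum by simp
  qed
  from choice[OF this] obtain J :: "'w \<Rightarrow> 'i \<Rightarrow> real set" where
    "\<forall>\<omega>. disjoint_family_on (J \<omega>) I \<and> (\<Union>i\<in>I. J \<omega> i) = {0..1} \<and>
      (\<forall>i\<in>I. J \<omega> i \<in> sets lebesgue \<and> measure lebesgue (J \<omega> i) = k \<omega> i)"
    by blast
  then have J: "\<And>\<omega>. disjoint_family_on (J \<omega>) I" "\<And>\<omega>. (\<Union>i\<in>I. J \<omega> i) = {0..1}"
    "\<And>\<omega> i. i \<in> I \<Longrightarrow> J \<omega> i \<in> sets lebesgue" "\<And>\<omega> i. i \<in> I \<Longrightarrow> measure lebesgue (J \<omega> i) = k \<omega> i"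
    by blast+
  define cell where "cell i = {(\<omega>, x). x \<in> J \<omega> i}" for i
  have state: "state_prob p (cell i) \<omega> = c i * q i $ \<omega>" if "i \<in> I" for i \<omega>
    using that by (simp add: state_prob_def cell_def J k_prod)
  have event: "event_prob p (cell i) = c i" if "i \<in> I" for i
    using q[OF that] that by (simp add: event_prob_def state Delta_def flip: sum_distrib_left)
  have post: "posterior p (cell i) = q i" if "i \<in> I" for i
    using c(1)[OF that] that by (simp add: posterior_def event state vec_eq_iff)
  have disj: "cell i \<inter> cell j = {}" if "i \<in> I" "j \<in> I" "i \<noteq> j" for i j
    using that J(1) by (auto simp: cell_def disjoint_family_on_def)
  \<comment> \<open>Positive probability excludes empty cells, so disjoint cells with different
    indices are different sets.\<close>
  have ne: "cell i \<noteq> {}" if "i \<in> I" for i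
    using event[OF that] c(1)[OF that] by (auto simp: event_prob_def)
  have inj: "inj_on cell I"
    using disj ne by (intro inj_onI) (metis Int_absorb)
  have "cell i \<in> sets (count_space UNIV \<Otimes>\<^sub>M lebesgue)" if "i \<in> I" for i
  proof -
    have "cell i = (\<Union>\<omega>. {\<omega>} \<times> J \<omega> i)" by (auto simp: cell_def)
    also have "\<dots> \<in> sets (count_space UNIV \<Otimes>\<^sub>M lebesgue)"
      using J(3) that by (intro sets.finite_UN pair_measureI) auto
    finally show ?thesis .
  qed
  moreover have "partition_on (UNIV \<times> {0..1}) (cell ` I)"
  proof (rule partition_onI)
    show "\<Union>(cell ` I) = UNIV \<times> {0..1}"
    proof -
      have "(\<omega>, x) \<in> \<Union>(cell ` I) \<longleftrightarrow> (\<omega>, x) \<in> UNIV \<times> {0..1}" for \<omega> x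
      proof -
        have "(\<omega>, x) \<in> \<Union>(cell ` I) \<longleftrightarrow> x \<in> (\<Union>i\<in>I. J \<omega> i)" by (auto simp: cell_def)
        then show ?thesis unfolding J(2) by simp
      qed
      then show ?thesis by (intro set_eqI) (simp only: split_paired_all)
    qed
    show "disjnt s s'" if "s \<in> cell ` I" "s' \<in> cell ` I" "s \<noteq> s'" for s s'
      using that disj by (auto simp: disjnt_def)
    show "{} \<notin> cell ` I"
      using ne by (metis imageE)
  qed
  ultimately have "is_experiment (cell ` I)"
    using I by (auto simp: is_experiment_def)
  from that[OF inj this event post] show thesis .
qed


section \<open>Equilibria of sub-games\<close>

text \<open>Carries the splitting over from indices to signals: distinct indices have distinct
  cells, so replies can be attached to cells, and the posterior after a cell is the belief it was
  built from.\<close>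

lemma optimal_experiment:
  fixes prior :: "real^'w::finite" and u v :: "'a::finite \<Rightarrow> 'w \<Rightarrow> real"
  assumes prior: "prior \<in> Delta"
  obtains \<sigma> a where "is_experiment \<sigma>" "\<And>s. s \<in> \<sigma> \<Longrightarrow> 0 < event_prob prior s"
    "\<And>s. s \<in> \<sigma> \<Longrightarrow> a s \<in> BR v (posterior prior s)"
    "(\<Sum>s\<in>\<sigma>. event_prob prior s * lin_ext u (a s) (posterior prior s)) = cav (ubar u v) prior"
    "\<And>s s' t b. s \<in> \<sigma> \<Longrightarrow> s' \<in> \<sigma> \<Longrightarrow> 0 \<le> t \<Longrightarrow> t \<le> 1 \<Longrightarrow>
       b \<in> BR v (t *\<^sub>R posterior prior s + (1 - t) *\<^sub>R posterior prior s') \<Longrightarrow>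
       lin_ext u b (t *\<^sub>R posterior prior s + (1 - t) *\<^sub>R posterior prior s') \<le>
         t * lin_ext u (a s) (posterior prior s) + (1 - t) * lin_ext u (a s') (posterior prior s')"
proof -
  obtain I :: "((real^'w) \<times> real) set" and c q a where I: "finite I" "I \<noteq> {}"
    and c: "\<And>i. i \<in> I \<Longrightarrow> 0 < c i" "sum c I = 1"
    and q: "\<And>i. i \<in> I \<Longrightarrow> q i \<in> Delta" "(\<Sum>i\<in>I. c i *\<^sub>R q i) = prior"
    and a: "\<And>i. i \<in> I \<Longrightarrow> a i \<in> BR v (q i)"
    "(\<Sum>i\<in>I. c i * lin_ext u (a i) (q i)) = cav (ubar u v) prior"
    and opt: "\<And>i j t b. i \<in> I \<Longrightarrow> j \<in> I \<Longrightarrow> 0 \<le> t \<Longrightarrow> t \<le> 1 \<Longrightarrow> b \<in> BR v (t *\<^sub>R q i + (1 - t) *\<^sub>R q j) \<Longrightarrow>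
       lin_ext u b (t *\<^sub>R q i + (1 - t) *\<^sub>R q j) \<le>
         t * lin_ext u (a i) (q i) + (1 - t) * lin_ext u (a j) (q j)"
    by (rule optimal_splitting[OF prior, of v u]) blast
  obtain cell where inj: "inj_on cell I" and exp: "is_experiment (cell ` I)"
    and event: "\<And>i. i \<in> I \<Longrightarrow> event_prob prior (cell i) = c i"
    and post: "\<And>i. i \<in> I \<Longrightarrow> posterior prior (cell i) = q i"
    using experiment_of_splitting[OF prior I c q] by blast
  define a' where "a' s = a (inv_into I cell s)" for s
  have a': "a' (cell i) = a i" if "i \<in> I" for i
    using inj that by (simp add: a'_def)
  show thesis
  proof (rule that[OF exp])
    show "(\<Sum>s\<in>cell ` I. event_prob prior s * lin_ext u (a' s) (posterior prior s)) = cav (ubar u v) prior"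
      unfolding a(2)[symmetric] sum.reindex[OF inj] by (simp add: event post a')
    show "\<And>s. s \<in> cell ` I \<Longrightarrow> 0 < event_prob prior s" using event c by auto
    show "\<And>s. s \<in> cell ` I \<Longrightarrow> a' s \<in> BR v (posterior prior s)" using post a a' by auto
    fix s s' :: "'w signal" and t b
    assume "s \<in> cell ` I" "s' \<in> cell ` I" "0 \<le> t" "t \<le> 1"
      "b \<in> BR v (t *\<^sub>R posterior prior s + (1 - t) *\<^sub>R posterior prior s')"
    then show "lin_ext u b (t *\<^sub>R posterior prior s + (1 - t) *\<^sub>R posterior prior s') \<le>
         t * lin_ext u (a' s) (posterior prior s) + (1 - t) * lin_ext u (a' s') (posterior prior s')"
      using opt by (auto simp: post a')
  qed
qed

text \<open>Unequal signal pairs have probability zero, and each joint probability factors into the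
  probability of the signal and the posterior. This yields the on-path payoffs.\<close>

lemma payoff_diagonal:
  assumes p: "p \<in> Delta" and \<sigma>: "is_experiment \<sigma>"
  shows "payoff p w \<sigma> \<sigma> (\<lambda>s. return_pmf (e1 s)) (\<lambda>s. return_pmf (e2 s)) act =
    (\<Sum>s\<in>\<sigma>. event_prob p s * lin_ext w (act (e1 s) (e2 s)) (posterior p s))"
proof -
  have "payoff p w \<sigma> \<sigma> (\<lambda>s. return_pmf (e1 s)) (\<lambda>s. return_pmf (e2 s)) act =
    (\<Sum>s1\<in>\<sigma>. \<Sum>\<omega>\<in>UNIV. \<Sum>s2\<in>\<sigma>. state_prob p (s1 \<inter> s2) \<omega> * (\<Sum>a\<in>UNIV. act (e1 s1) (e2 s2) $ a * w a \<omega>))"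
    unfolding payoff_def msg_payoff_def by (subst sum.swap[of _ _ \<sigma>]) simp
  also have "\<dots> = (\<Sum>s\<in>\<sigma>. \<Sum>\<omega>\<in>UNIV. state_prob p s \<omega> * (\<Sum>a\<in>UNIV. act (e1 s) (e2 s) $ a * w a \<omega>))"
    by (simp add: sum_state_prob_same[OF \<sigma>] cong: sum.cong)
  also have "\<dots> = (\<Sum>s\<in>\<sigma>. event_prob p s * lin_ext w (act (e1 s) (e2 s)) (posterior p s))"
    by (simp add: lin_ext_state_sum sum_distrib_left state_prob_eq_posterior[OF p] mult_ac)
  finally show ?thesis .
qed

lemma payoff_constant_action:
  assumes "is_experiment \<sigma>1" "is_experiment \<sigma>2"
  shows "payoff p w \<sigma>1 \<sigma>2 t1 t2 (\<lambda>_ _. \<alpha>) = lin_ext w \<alpha> p"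
proof -
  have "payoff p w \<sigma>1 \<sigma>2 t1 t2 (\<lambda>_ _. \<alpha>) =
    (\<Sum>s1\<in>\<sigma>1. \<Sum>s2\<in>\<sigma>2. \<Sum>\<omega>\<in>UNIV. state_prob p (s1 \<inter> s2) \<omega> * (\<Sum>a\<in>UNIV. \<alpha> $ a * w a \<omega>))"
    by (simp add: payoff_def msg_payoff_def)
  also have "\<dots> = (\<Sum>\<omega>\<in>UNIV. \<Sum>s1\<in>\<sigma>1. \<Sum>s2\<in>\<sigma>2. state_prob p (s1 \<inter> s2) \<omega> * (\<Sum>a\<in>UNIV. \<alpha> $ a * w a \<omega>))"
    by (subst sum.swap[of _ UNIV \<sigma>2], subst sum.swap[of _ UNIV \<sigma>1]) (rule refl)
  also have "\<dots> = lin_ext w \<alpha> p"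
    using assms by (simp add: lin_ext_state_sum sum_state_prob_pair flip: sum_distrib_right)
  finally show ?thesis .
qed

text \<open>Messages are ignored, so none is better than another, and they carry no information, so
  the belief remains the prior. After unexpected messages the prior is still admissible: it is the
  average of the posteriors after signal pairs, weighted by their probabilities.\<close>

lemma babbling_equilibrium:
  fixes p :: "real^'w::finite" and v w1 w2 :: "'a::finite \<Rightarrow> 'w \<Rightarrow> real"
  assumes p: "p \<in> Delta" and \<sigma>: "is_experiment \<sigma>1" "is_experiment \<sigma>2"
    and m: "n1 \<in> M1" "n2 \<in> M2" and \<alpha>: "\<alpha> \<in> BR v p"
  shows "subgame_equilibrium p w1 w2 v M1 M2 \<sigma>1 \<sigma>2 (\<lambda>_. return_pmf n1) (\<lambda>_. return_pmf n2)
    (\<lambda>_ _. \<alpha>) (\<lambda>_ _. p)"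
proof -
  let ?t1 = "\<lambda>_ :: 'w signal. return_pmf n1" and ?t2 = "\<lambda>_ :: 'w signal. return_pmf n2"
  have state: "state_msg_prob p \<sigma>1 \<sigma>2 ?t1 ?t2 m1 m2 \<omega> = (if m1 = n1 \<and> m2 = n2 then p $ \<omega> else 0)"
    for m1 m2 \<omega>
    by (auto simp: state_msg_prob_def sum_state_prob_pair[OF \<sigma>])
  have msg: "msg_prob p \<sigma>1 \<sigma>2 ?t1 ?t2 m1 m2 = (if m1 = n1 \<and> m2 = n2 then 1 else 0)" for m1 m2
  proof (cases "m1 = n1 \<and> m2 = n2")
    case False
    then have "state_msg_prob p \<sigma>1 \<sigma>2 ?t1 ?t2 m1 m2 \<omega> = 0" for \<omega> unfolding state by auto
    with False show ?thesis by (auto simp: msg_prob_def)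
  qed (use p in \<open>simp add: msg_prob_def state Delta_def\<close>)
  let ?C = "{posterior p (s1 \<inter> s2) |s1 s2. s1 \<in> \<sigma>1 \<and> s2 \<in> \<sigma>2 \<and> 0 < event_prob p (s1 \<inter> s2)}"
  have "p \<in> convex hull ?C"
  proof -
    \<comment> \<open>Only pairs of positive probability generate the hull; null pairs contribute
      nothing to the average.\<close>
    define S where "S = {x \<in> \<sigma>1 \<times> \<sigma>2. 0 < event_prob p (fst x \<inter> snd x)}"
    define E where "E x = fst x \<inter> snd x" for x :: "'w signal \<times> 'w signal"
    have fin: "finite (\<sigma>1 \<times> \<sigma>2)" using \<sigma> by (simp add: is_experiment_def)
    have zero: "event_prob p (E x) = 0" if "x \<in> \<sigma>1 \<times> \<sigma>2 - S" for x
      using that event_prob_nonneg[OF p, of "E x"] by (auto simp: S_def E_def)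
    have to_S: "(\<Sum>x\<in>S. event_prob p (E x) * f x) = (\<Sum>x\<in>\<sigma>1\<times>\<sigma>2. event_prob p (E x) * f x)" for f
      using zero fin by (intro sum.mono_neutral_left) (auto simp: S_def)
    have "p $ \<omega> = (\<Sum>x\<in>\<sigma>1\<times>\<sigma>2. event_prob p (E x) * posterior p (E x) $ \<omega>)" for \<omega>
      using sum_state_prob_pair[OF \<sigma>, of p \<omega>]
      by (simp add: sum.cartesian_product E_def state_prob_eq_posterior[OF p, symmetric] case_prod_beta')
    then have comb: "(\<Sum>x\<in>S. event_prob p (E x) *\<^sub>R posterior p (E x)) = p"
      by (simp add: vec_eq_iff to_S)
    have "(\<Sum>x\<in>S. event_prob p (E x)) = (\<Sum>x\<in>\<sigma>1\<times>\<sigma>2. event_prob p (E x))"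
      using to_S[of "\<lambda>_. 1"] by simp
    also have "\<dots> = (\<Sum>s1\<in>\<sigma>1. \<Sum>s2\<in>\<sigma>2. event_prob p (s1 \<inter> s2))"
      by (simp add: sum.cartesian_product E_def case_prod_beta')
    also have "\<dots> = (\<Sum>s1\<in>\<sigma>1. \<Sum>s2\<in>\<sigma>2. \<Sum>\<omega>\<in>UNIV. state_prob p (s1 \<inter> s2) \<omega>)"
      unfolding event_prob_def ..
    also have "\<dots> = (\<Sum>\<omega>\<in>UNIV. \<Sum>s1\<in>\<sigma>1. \<Sum>s2\<in>\<sigma>2. state_prob p (s1 \<inter> s2) \<omega>)"
      by (subst sum.swap[of _ UNIV \<sigma>2], subst sum.swap[of _ UNIV \<sigma>1]) (rule refl)
    also have "\<dots> = 1"
      using p by (simp add: sum_state_prob_pair[OF \<sigma>] Delta_def)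
    finally have one: "(\<Sum>x\<in>S. event_prob p (E x)) = 1" .
    have "finite S" using fin by (simp add: S_def)
    moreover have "posterior p (E x) \<in> convex hull ?C" if "x \<in> S" for x
      using that by (intro hull_inc CollectI exI[of _ "fst x"] exI[of _ "snd x"]) (auto simp: S_def E_def)
    ultimately have "(\<Sum>x\<in>S. event_prob p (E x) *\<^sub>R posterior p (E x)) \<in> convex hull ?C"
      using one by (intro convex_sum) (auto simp: event_prob_nonneg[OF p])
    then show ?thesis by (simp add: comb)
  qed
  then have "consistent_belief p \<sigma>1 \<sigma>2 ?t1 ?t2 m1 m2 p" for m1 m2
    by (simp add: consistent_belief_def msg state vec_eq_iff)
  then show ?thesis
    using m \<alpha> by (simp add: subgame_equilibrium_def interim_payoff1_def interim_payoff2_def msg_payoff_def)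
qed

section \<open>Truthful reporting in a sub-game\<close>

lemma integrable_measure_pmf_finite_range:
  fixes f :: "'m \<Rightarrow> real"
  assumes "finite (range f)"
  shows "integrable (measure_pmf \<mu>) f"
proof -
  obtain B where "\<And>m. norm (f m) \<le> B"
    using finite_imp_bounded[OF assms] by (auto simp: bounded_iff)
  then show ?thesis
    by (intro measure_pmf.integrable_const_bound[where B = B]) auto
qed

text \<open>A deviation may mix over infinitely many messages, but the decoded reply takes finitely
  many values; this gives the integrability needed to exchange the sum over states with the
  expectation.\<close>

lemma expectation_vec_combination:
  fixes f :: "'m \<Rightarrow> real^'a::finite"
  assumes "finite (range f)"
  shows "(\<Sum>\<omega>\<in>UNIV. r \<omega> * measure_pmf.expectation \<mu> (\<lambda>m. \<Sum>a\<in>UNIV. f m $ a * w a \<omega>)) =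
    measure_pmf.expectation \<mu> (\<lambda>m. \<Sum>\<omega>\<in>UNIV. r \<omega> * (\<Sum>a\<in>UNIV. f m $ a * (w a \<omega> :: real)))"
proof -
  have "integrable (measure_pmf \<mu>) (\<lambda>m. \<Sum>a\<in>UNIV. f m $ a * w a \<omega>)" for \<omega>
    using finite_imageI[OF assms, of "\<lambda>\<alpha>. \<Sum>a\<in>UNIV. \<alpha> $ a * w a \<omega>"]
    by (intro integrable_measure_pmf_finite_range) (simp add: image_image)
  then show ?thesis by simp
qed

lemma expectation_pmf_le:
  fixes f :: "'m \<Rightarrow> real"
  assumes "finite (range f)" "\<And>m. f m \<le> B"
  shows "measure_pmf.expectation \<mu> f \<le> B"
proof -
  have "measure_pmf.expectation \<mu> f \<le> measure_pmf.expectation \<mu> (\<lambda>_. B)"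
    using assms(2) by (intro integral_mono integrable_measure_pmf_finite_range assms(1)) auto
  then show ?thesis by simp
qed

text \<open>\<open>d1\<close> and \<open>d2\<close> read every message, even one encoding no signal,
  as a signal of \<open>\<sigma>\<close>, so any deviation amounts to a possibly random misreport,
  which \<open>dev1\<close> and \<open>dev2\<close> deter. Unmatched message pairs have probability
  zero, so every belief between the two decoded posteriors is consistent.\<close>

lemma truthful_reporting_equilibrium:
  fixes p :: "real^'w::finite" and v w1 w2 :: "'a::finite \<Rightarrow> 'w \<Rightarrow> real"
  assumes p: "p \<in> Delta" and \<sigma>: "is_experiment \<sigma>" and pos: "\<And>s. s \<in> \<sigma> \<Longrightarrow> 0 < event_prob p s"
    and e1: "e1 ` \<sigma> \<subseteq> M1" "\<And>m. d1 m \<in> \<sigma>" "\<And>s. s \<in> \<sigma> \<Longrightarrow> d1 (e1 s) = s"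
    and e2: "e2 ` \<sigma> \<subseteq> M2" "\<And>m. d2 m \<in> \<sigma>" "\<And>s. s \<in> \<sigma> \<Longrightarrow> d2 (e2 s) = s"
    and B: "\<And>s s'. s \<in> \<sigma> \<Longrightarrow> s' \<in> \<sigma> \<Longrightarrow> B s s' \<in> closed_segment (posterior p s) (posterior p s')"
    and A: "\<And>s s'. s \<in> \<sigma> \<Longrightarrow> s' \<in> \<sigma> \<Longrightarrow> A s s' \<in> BR v (B s s')"
    and dev1: "\<And>s s'. s \<in> \<sigma> \<Longrightarrow> s' \<in> \<sigma> \<Longrightarrow>
      lin_ext w1 (A s' s) (posterior p s) \<le> lin_ext w1 (A s s) (posterior p s)"
    and dev2: "\<And>s s'. s \<in> \<sigma> \<Longrightarrow> s' \<in> \<sigma> \<Longrightarrow>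
      lin_ext w2 (A s s') (posterior p s) \<le> lin_ext w2 (A s s) (posterior p s)"
  shows "subgame_equilibrium p w1 w2 v M1 M2 \<sigma> \<sigma> (\<lambda>s. return_pmf (e1 s)) (\<lambda>s. return_pmf (e2 s))
    (\<lambda>m1 m2. A (d1 m1) (d2 m2)) (\<lambda>m1 m2. B (d1 m1) (d2 m2))"
proof -
  let ?t1 = "\<lambda>s. return_pmf (e1 s)" and ?t2 = "\<lambda>s. return_pmf (e2 s)"
  let ?act = "\<lambda>m1 m2. A (d1 m1) (d2 m2)"
  have fin: "finite \<sigma>" using \<sigma> by (simp add: is_experiment_def)
  have B_diag: "B s s = posterior p s" if "s \<in> \<sigma>" for s
    using B[OF that that] by simp
  have consistent: "consistent_belief p \<sigma> \<sigma> ?t1 ?t2 m1 m2 (B (d1 m1) (d2 m2))" for m1 m2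
  proof -
    have state: "state_msg_prob p \<sigma> \<sigma> ?t1 ?t2 m1 m2 \<omega> =
      (\<Sum>s\<in>\<sigma>. state_prob p s \<omega> * (pmf (return_pmf (e1 s)) m1 * pmf (return_pmf (e2 s)) m2))" for \<omega>
      unfolding state_msg_prob_def
      by (rule sum.cong[OF refl]) (simp only: mult.assoc sum_state_prob_same[OF \<sigma>])
    show ?thesis
    \<comment> \<open>Bayes' rule applies exactly to the pairs that encode one common signal. All
      others, including stray messages with equal decodings, have probability zero.\<close>
    proof (cases "\<exists>s\<in>\<sigma>. m1 = e1 s \<and> m2 = e2 s")
      case True
      then obtain s where s: "s \<in> \<sigma>" "m1 = e1 s" "m2 = e2 s" by blast
      have select: "state_prob p s' \<omega> * (pmf (return_pmf (e1 s')) m1 * pmf (return_pmf (e2 s')) m2) =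
          (if s' = s then state_prob p s' \<omega> else 0)" if "s' \<in> \<sigma>" for s' \<omega>
      proof (cases "s' = s")
        case False
        then have "e1 s' \<noteq> m1" using e1(3)[OF that] e1(3)[OF s(1)] s(2) by metis
        with False show ?thesis by (simp add: indicator_def)
      qed (simp add: s)
      have st: "state_msg_prob p \<sigma> \<sigma> ?t1 ?t2 m1 m2 \<omega> = state_prob p s \<omega>" for \<omega>
      proof -
        have "state_msg_prob p \<sigma> \<sigma> ?t1 ?t2 m1 m2 \<omega> = (\<Sum>s'\<in>\<sigma>. if s' = s then state_prob p s' \<omega> else 0)"
          unfolding state by (rule sum.cong[OF refl select])
        then show ?thesis using fin s(1) by simp
      qed
      then have msg: "msg_prob p \<sigma> \<sigma> ?t1 ?t2 m1 m2 = event_prob p s"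
        by (simp add: msg_prob_def event_prob_def)
      then show ?thesis
        unfolding consistent_belief_def st msg
        using s pos[OF s(1)] e1(3)[OF s(1)] e2(3)[OF s(1)] B_diag[OF s(1)] by (simp add: posterior_def)
    next
      case False
      then have "state_msg_prob p \<sigma> \<sigma> ?t1 ?t2 m1 m2 \<omega> = 0" for \<omega>
        unfolding state by (intro sum.neutral) (auto simp: indicator_def)
      then have zero: "msg_prob p \<sigma> \<sigma> ?t1 ?t2 m1 m2 = 0" by (simp add: msg_prob_def)
      let ?C = "{posterior p (s1 \<inter> s2) |s1 s2. s1 \<in> \<sigma> \<and> s2 \<in> \<sigma> \<and> 0 < event_prob p (s1 \<inter> s2)}"
      \<comment> \<open>The pair \<open>(s, s)\<close> has intersection \<open>s\<close>, so the
        posterior of a single signal is among those allowed.\<close>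
      have C: "posterior p s \<in> ?C" if "s \<in> \<sigma>" for s
        using that pos by (auto intro!: exI[of _ s])
      have "closed_segment (posterior p (d1 m1)) (posterior p (d2 m2)) \<subseteq> convex hull ?C"
        by (rule closed_segment_subset[OF hull_inc[OF C[OF e1(2)]] hull_inc[OF C[OF e2(2)]] convex_convex_hull])
      then show ?thesis
        using B[OF e1(2) e2(2)] zero by (auto simp: consistent_belief_def)
    qed
  qed
  have range1: "finite (range (\<lambda>m. ?act m m2))" for m2
    by (rule finite_subset[of _ "(\<lambda>s. A s (d2 m2)) ` \<sigma>"]) (use e1 fin in auto)
  have range2: "finite (range (?act m1))" for m1
    by (rule finite_subset[of _ "A (d1 m1) ` \<sigma>"]) (use e2 fin in auto)
  \<comment> \<open>Given \<open>s\<close>, expert 2 has observed \<open>s\<close> as well and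
    reports \<open>e2 s\<close>, so only the message of expert 1 is random.\<close>
  have interim1: "interim_payoff1 p w1 \<sigma> ?t2 ?act s \<mu> =
    measure_pmf.expectation \<mu> (\<lambda>m. lin_ext w1 (?act m (e2 s)) (posterior p s))" if s: "s \<in> \<sigma>" for s \<mu>
  proof -
    have "(\<Sum>s2\<in>\<sigma>. \<Sum>\<omega>\<in>UNIV. state_prob p (s \<inter> s2) \<omega> * msg_payoff w1 ?act \<mu> (?t2 s2) \<omega>) =
      (\<Sum>\<omega>\<in>UNIV. state_prob p s \<omega> * msg_payoff w1 ?act \<mu> (?t2 s) \<omega>)"
      by (subst sum.swap) (simp only: sum_state_prob_same[OF \<sigma> s])
    also have "\<dots> = event_prob p s * (\<Sum>\<omega>\<in>UNIV. posterior p s $ \<omega> * msg_payoff w1 ?act \<mu> (?t2 s) \<omega>)"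
      by (simp add: state_prob_eq_posterior[OF p] sum_distrib_left mult.assoc)
    also have "(\<Sum>\<omega>\<in>UNIV. posterior p s $ \<omega> * msg_payoff w1 ?act \<mu> (?t2 s) \<omega>) =
      measure_pmf.expectation \<mu> (\<lambda>m. lin_ext w1 (?act m (e2 s)) (posterior p s))"
      unfolding msg_payoff_def lin_ext_state_sum
      by (simp only: expectation_return_pmf expectation_vec_combination[OF range1])
    finally show ?thesis
      using pos[OF s] by (simp add: interim_payoff1_def)
  qed
  have interim2: "interim_payoff2 p w2 \<sigma> ?t1 ?act s \<mu> =
    measure_pmf.expectation \<mu> (\<lambda>m. lin_ext w2 (?act (e1 s) m) (posterior p s))" if s: "s \<in> \<sigma>" for s \<mu>
  proof -
    have "(\<Sum>s1\<in>\<sigma>. \<Sum>\<omega>\<in>UNIV. state_prob p (s1 \<inter> s) \<omega> * msg_payoff w2 ?act (?t1 s1) \<mu> \<omega>) =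
      (\<Sum>\<omega>\<in>UNIV. state_prob p s \<omega> * msg_payoff w2 ?act (?t1 s) \<mu> \<omega>)"
      by (subst sum.swap) (simp only: Int_commute[of _ s] sum_state_prob_same[OF \<sigma> s])
    also have "\<dots> = event_prob p s * (\<Sum>\<omega>\<in>UNIV. posterior p s $ \<omega> * msg_payoff w2 ?act (?t1 s) \<mu> \<omega>)"
      by (simp add: state_prob_eq_posterior[OF p] sum_distrib_left mult.assoc)
    also have "(\<Sum>\<omega>\<in>UNIV. posterior p s $ \<omega> * msg_payoff w2 ?act (?t1 s) \<mu> \<omega>) =
      measure_pmf.expectation \<mu> (\<lambda>m. lin_ext w2 (?act (e1 s) m) (posterior p s))"
      unfolding msg_payoff_def lin_ext_state_sum
      by (simp only: expectation_return_pmf expectation_vec_combination[OF range2])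
    finally show ?thesis
      using pos[OF s] by (simp add: interim_payoff2_def)
  qed
  have opt1: "interim_payoff1 p w1 \<sigma> ?t2 ?act s \<mu> \<le> interim_payoff1 p w1 \<sigma> ?t2 ?act s (?t1 s)"
    if s: "s \<in> \<sigma>" for s \<mu>
  proof -
    have "finite (range (\<lambda>m. lin_ext w1 (?act m (e2 s)) (posterior p s)))"
      using finite_imageI[OF range1, of "\<lambda>\<alpha>. lin_ext w1 \<alpha> (posterior p s)"] by (simp add: image_image)
    then show ?thesis
      unfolding interim1[OF s] using s e1 e2 dev1
      by (simp only: expectation_return_pmf) (intro expectation_pmf_le; simp)
  qed
  have opt2: "interim_payoff2 p w2 \<sigma> ?t1 ?act s \<mu> \<le> interim_payoff2 p w2 \<sigma> ?t1 ?act s (?t2 s)"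
    if s: "s \<in> \<sigma>" for s \<mu>
  proof -
    have "finite (range (\<lambda>m. lin_ext w2 (?act (e1 s) m) (posterior p s)))"
      using finite_imageI[OF range2, of "\<lambda>\<alpha>. lin_ext w2 \<alpha> (posterior p s)"] by (simp add: image_image)
    then show ?thesis
      unfolding interim2[OF s] using s e1 e2 dev2
      by (simp only: expectation_return_pmf) (intro expectation_pmf_le; simp)
  qed
  show ?thesis
    unfolding subgame_equilibrium_def
    using e1 e2 A consistent opt1 opt2 by auto
qed


section \<open>The truthful equilibrium\<close>

text \<open>Value of information: \<open>\<alpha>\<close> remains available after every signal,
  where a best reply does at least as well, and \<open>v\<close> is linear in the belief.\<close>

lemma BR_value_le_split:
  assumes p: "p \<in> Delta" and \<sigma>: "is_experiment \<sigma>" and \<alpha>: "\<alpha> \<in> Delta"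
    and a: "\<And>s. s \<in> \<sigma> \<Longrightarrow> a s \<in> BR v (posterior p s)"
  shows "lin_ext v \<alpha> p \<le> (\<Sum>s\<in>\<sigma>. event_prob p s * lin_ext v (a s) (posterior p s))"
proof -
  have "p = (\<Sum>s\<in>\<sigma>. event_prob p s *\<^sub>R posterior p s)"
    by (simp add: vec_eq_iff sum_state_prob_single[OF \<sigma>] flip: state_prob_eq_posterior[OF p])
  then have "lin_ext v \<alpha> p = lin_ext v \<alpha> (\<Sum>s\<in>\<sigma>. event_prob p s *\<^sub>R posterior p s)" by simp
  also have "\<dots> = (\<Sum>s\<in>\<sigma>. event_prob p s * lin_ext v \<alpha> (posterior p s))"
    by (simp add: linear_sum[OF linear_lin_ext_right] linear_scale[OF linear_lin_ext_right])
  also have "\<dots> \<le> (\<Sum>s\<in>\<sigma>. event_prob p s * lin_ext v (a s) (posterior p s))"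
    using a \<alpha> event_prob_nonneg[OF p] by (intro sum_mono mult_left_mono) (auto simp: BR_def)
  finally show ?thesis .
qed

text \<open>A left inverse of the encoding, made total by reading every other message as an
  arbitrary signal.\<close>

lemma signal_decoder:
  assumes "signal_encoding M enc" "is_experiment \<sigma>"
  obtains d where "\<And>m. d m \<in> \<sigma>" "\<And>s. s \<in> \<sigma> \<Longrightarrow> d (enc \<sigma> s) = s"
proof -
  obtain s0 where s0: "s0 \<in> \<sigma>" using experiment_nonempty[OF assms(2)] by blast
  have inj: "inj_on (enc \<sigma>) \<sigma>" using assms by (simp add: signal_encoding_def)
  show thesis
    by (rule that[of "\<lambda>m. if m \<in> enc \<sigma> ` \<sigma> then inv_into \<sigma> (enc \<sigma>) m else s0"])
      (use s0 inj in \<open>auto simp: inv_into_into\<close>)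
qed

theorem mainTheorem3:
  fixes prior :: "real^'w::finite"
    and u v :: "'a::finite \<Rightarrow> 'w \<Rightarrow> real"
    and \<beta> :: real
    and M1 :: "'m1 set" and M2 :: "'m2 set"
    and enc1 :: "'w stat_experiment \<Rightarrow> 'w signal \<Rightarrow> 'm1"
    and enc2 :: "'w stat_experiment \<Rightarrow> 'w signal \<Rightarrow> 'm2"
  assumes "prior \<in> Delta"
    and "0 \<le> \<beta>" and "\<beta> \<le> 1"
    and "signal_encoding M1 enc1" and "signal_encoding M2 enc2"
  shows "\<exists>\<sigma>1 \<tau>1 \<sigma>2 \<tau>2 \<alpha> bel.
    equilibrium prior u (\<lambda>a \<omega>. \<beta> * u a \<omega> + (1 - \<beta>) * v a \<omega>) v M1 M2 \<sigma>1 \<tau>1 \<sigma>2 \<tau>2 \<alpha> bel \<and>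
    truthful enc1 enc2 \<sigma>1 \<tau>1 \<sigma>2 \<tau>2 \<and>
    payoff prior u \<sigma>1 \<sigma>2 (\<tau>1 \<sigma>1 \<sigma>2) (\<tau>2 \<sigma>2 \<sigma>1) (\<alpha> \<sigma>1 \<sigma>2) = cav (ubar u v) prior"
proof -
  define w2 where "w2 = (\<lambda>a \<omega>. \<beta> * u a \<omega> + (1 - \<beta>) * v a \<omega>)"
  have w2: "lin_ext w2 \<alpha> p = \<beta> * lin_ext u \<alpha> p + (1 - \<beta>) * lin_ext v \<alpha> p" for \<alpha> p
    unfolding w2_def by (rule lin_ext_combination)
  note \<beta> = assms(2,3)
  obtain \<sigma> a where \<sigma>: "is_experiment \<sigma>" and pos: "\<And>s. s \<in> \<sigma> \<Longrightarrow> 0 < event_prob prior s"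
    and a: "\<And>s. s \<in> \<sigma> \<Longrightarrow> a s \<in> BR v (posterior prior s)"
    and a_value: "(\<Sum>s\<in>\<sigma>. event_prob prior s * lin_ext u (a s) (posterior prior s)) = cav (ubar u v) prior"
    and opt: "\<And>s s' t b. s \<in> \<sigma> \<Longrightarrow> s' \<in> \<sigma> \<Longrightarrow> 0 \<le> t \<Longrightarrow> t \<le> 1 \<Longrightarrow>
       b \<in> BR v (t *\<^sub>R posterior prior s + (1 - t) *\<^sub>R posterior prior s') \<Longrightarrow>
       lin_ext u b (t *\<^sub>R posterior prior s + (1 - t) *\<^sub>R posterior prior s') \<le>
         t * lin_ext u (a s) (posterior prior s) + (1 - t) * lin_ext u (a s') (posterior prior s')"
    by (rule optimal_experiment[OF assms(1), of v u]) blast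
  \<comment> \<open>A belief and a reply after the reports \<open>s\<close> and \<open>s'\<close>
    that keep \<open>u\<close> at or below its on-path level, whichever of the two reports is the
    true one.\<close>
  define P where "P s s' z \<alpha> \<longleftrightarrow> z \<in> closed_segment (posterior prior s) (posterior prior s') \<and> \<alpha> \<in> BR v z \<and>
    lin_ext u \<alpha> (posterior prior s) \<le> lin_ext u (a s) (posterior prior s) \<and>
    lin_ext u \<alpha> (posterior prior s') \<le> lin_ext u (a s') (posterior prior s')" for s s' z \<alpha>
  \<comment> \<open>The clause for \<open>s = s'\<close> fixes the on-path reply: another reply
    satisfying \<open>P\<close> could give expert 1 less.\<close>
  have "\<exists>z \<alpha>. P s s' z \<alpha> \<and> (s = s' \<longrightarrow> \<alpha> = a s)" if s: "s \<in> \<sigma>" "s' \<in> \<sigma>" for s s'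
  proof (cases "s = s'")
    case True
    then have "P s s' (posterior prior s) (a s)" using a s by (simp add: P_def)
    with True show ?thesis by blast
  next
    case False
    have "\<exists>z\<in>closed_segment (posterior prior s) (posterior prior s'). \<exists>\<alpha>\<in>BR v z.
      lin_ext u \<alpha> (posterior prior s) \<le> lin_ext u (a s) (posterior prior s) \<and>
      lin_ext u \<alpha> (posterior prior s') \<le> lin_ext u (a s') (posterior prior s')"
      using s pos opt[OF s] assms(1)
      by (intro common_punishment posterior_Delta)
        (simp_all add: linear_add[OF linear_lin_ext_right] linear_scale[OF linear_lin_ext_right])
    with False show ?thesis by (auto simp: P_def)
  qed
  then obtain B A where AB: "\<And>s s'. s \<in> \<sigma> \<Longrightarrow> s' \<in> \<sigma> \<Longrightarrow> P s s' (B s s') (A s s')"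
    and A_diag: "\<And>s. s \<in> \<sigma> \<Longrightarrow> A s s = a s"
    by metis
  obtain d1 where d1: "\<And>m. d1 m \<in> \<sigma>" "\<And>s. s \<in> \<sigma> \<Longrightarrow> d1 (enc1 \<sigma> s) = s"
    using signal_decoder[OF assms(4) \<sigma>] by blast
  obtain d2 where d2: "\<And>m. d2 m \<in> \<sigma>" "\<And>s. s \<in> \<sigma> \<Longrightarrow> d2 (enc2 \<sigma> s) = s"
    using signal_decoder[OF assms(5) \<sigma>] by blast
  have enc: "enc1 \<sigma> ` \<sigma> \<subseteq> M1" "enc2 \<sigma> ` \<sigma> \<subseteq> M2"
    using assms(4,5) \<sigma> by (auto simp: signal_encoding_def)
  then obtain n1 n2 where n: "n1 \<in> M1" "n2 \<in> M2"
    using experiment_nonempty[OF \<sigma>] by blast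
  obtain \<alpha>0 where \<alpha>0: "\<alpha>0 \<in> BR v prior" using BR_nonempty by blast

  \<comment> \<open>Truth-telling is confined to the sub-game in which both experts choose
    \<open>\<sigma>\<close>; in all others they babble. The condition is symmetric, so it suits the
    order of arguments in \<open>\<tau>2\<close> too.\<close>
  define \<tau>1 :: "'w stat_experiment \<Rightarrow> 'w stat_experiment \<Rightarrow> 'w signal \<Rightarrow> 'm1 pmf" where
    "\<tau>1 \<rho> \<rho>' = (if \<rho> = \<sigma> \<and> \<rho>' = \<sigma> then (\<lambda>s. return_pmf (enc1 \<sigma> s)) else (\<lambda>_. return_pmf n1))" for \<rho> \<rho>'
  define \<tau>2 :: "'w stat_experiment \<Rightarrow> 'w stat_experiment \<Rightarrow> 'w signal \<Rightarrow> 'm2 pmf" where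
    "\<tau>2 \<rho> \<rho>' = (if \<rho> = \<sigma> \<and> \<rho>' = \<sigma> then (\<lambda>s. return_pmf (enc2 \<sigma> s)) else (\<lambda>_. return_pmf n2))" for \<rho> \<rho>'
  define \<alpha> where
    "\<alpha> \<rho> \<rho>' = (if \<rho> = \<sigma> \<and> \<rho>' = \<sigma> then (\<lambda>m1 m2. A (d1 m1) (d2 m2)) else (\<lambda>_ _. \<alpha>0))" for \<rho> \<rho>'
  define bel where
    "bel \<rho> \<rho>' = (if \<rho> = \<sigma> \<and> \<rho>' = \<sigma> then (\<lambda>m1 m2. B (d1 m1) (d2 m2)) else (\<lambda>_ _. prior))" for \<rho> \<rho>'

  have truthful_subgame: "subgame_equilibrium prior u w2 v M1 M2 \<sigma> \<sigma>
      (\<lambda>s. return_pmf (enc1 \<sigma> s)) (\<lambda>s. return_pmf (enc2 \<sigma> s))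
      (\<lambda>m1 m2. A (d1 m1) (d2 m2)) (\<lambda>m1 m2. B (d1 m1) (d2 m2))"
  proof (rule truthful_reporting_equilibrium[OF assms(1) \<sigma> pos enc(1) d1 enc(2) d2])
    fix s s' assume s: "s \<in> \<sigma>" "s' \<in> \<sigma>"
    show "B s s' \<in> closed_segment (posterior prior s) (posterior prior s')" "A s s' \<in> BR v (B s s')"
      using AB[OF s] by (auto simp: P_def)
    \<comment> \<open>The true signal is the second index here, so the swapped instance of
      \<open>AB\<close> is used, with its bound at the second posterior.\<close>
    show "lin_ext u (A s' s) (posterior prior s) \<le> lin_ext u (A s s) (posterior prior s)"
      using AB[OF s(2,1)] by (simp add: P_def A_diag s)
    have "lin_ext u (A s s') (posterior prior s) \<le> lin_ext u (A s s) (posterior prior s)"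
      using AB[OF s] by (simp add: P_def A_diag s)
    \<comment> \<open>\<open>a s\<close> is a best reply at the true posterior, so no other reply
      gives more in \<open>v\<close>.\<close>
    moreover have "lin_ext v (A s s') (posterior prior s) \<le> lin_ext v (A s s) (posterior prior s)"
      using AB[OF s] a[OF s(1)] by (auto simp: P_def A_diag s BR_def)
    ultimately show "lin_ext w2 (A s s') (posterior prior s) \<le> lin_ext w2 (A s s) (posterior prior s)"
      unfolding w2 using \<beta> by (intro add_mono mult_left_mono) auto
  qed
  have subgames: "subgame_equilibrium prior u w2 v M1 M2 \<rho>1 \<rho>2 (\<tau>1 \<rho>1 \<rho>2) (\<tau>2 \<rho>2 \<rho>1) (\<alpha> \<rho>1 \<rho>2) (bel \<rho>1 \<rho>2)"
    if "is_experiment \<rho>1" "is_experiment \<rho>2" for \<rho>1 \<rho>2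
  proof (cases "\<rho>1 = \<sigma> \<and> \<rho>2 = \<sigma>")
    case True
    then show ?thesis using truthful_subgame by (simp add: \<tau>1_def \<tau>2_def \<alpha>_def bel_def)
  next
    case False
    have "subgame_equilibrium prior u w2 v M1 M2 \<rho>1 \<rho>2 (\<lambda>_. return_pmf n1) (\<lambda>_. return_pmf n2)
      (\<lambda>_ _. \<alpha>0) (\<lambda>_ _. prior)"
      using that n \<alpha>0 assms(1) by (intro babbling_equilibrium)
    moreover have "\<tau>1 \<rho>1 \<rho>2 = (\<lambda>_. return_pmf n1)" "\<tau>2 \<rho>2 \<rho>1 = (\<lambda>_. return_pmf n2)"
      "\<alpha> \<rho>1 \<rho>2 = (\<lambda>_ _. \<alpha>0)" "bel \<rho>1 \<rho>2 = (\<lambda>_ _. prior)"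
      using False by (auto simp: \<tau>1_def \<tau>2_def \<alpha>_def bel_def)
    ultimately show ?thesis by simp
  qed
  have on_path: "payoff prior w \<sigma> \<sigma> (\<tau>1 \<sigma> \<sigma>) (\<tau>2 \<sigma> \<sigma>) (\<alpha> \<sigma> \<sigma>) =
    (\<Sum>s\<in>\<sigma>. event_prob prior s * lin_ext w (a s) (posterior prior s))" for w
    by (simp add: \<tau>1_def \<tau>2_def \<alpha>_def payoff_diagonal[OF assms(1) \<sigma>] d1 d2 A_diag)
  have off_path: "payoff prior w \<rho>1 \<rho>2 (\<tau>1 \<rho>1 \<rho>2) (\<tau>2 \<rho>2 \<rho>1) (\<alpha> \<rho>1 \<rho>2) = lin_ext w \<alpha>0 prior"
    if "is_experiment \<rho>1" "is_experiment \<rho>2" "\<not> (\<rho>1 = \<sigma> \<and> \<rho>2 = \<sigma>)" for w \<rho>1 \<rho>2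
  proof -
    have "\<alpha> \<rho>1 \<rho>2 = (\<lambda>_ _. \<alpha>0)" using that(3) by (auto simp: \<alpha>_def)
    then show ?thesis using payoff_constant_action[OF that(1,2)] by metis
  qed
  \<comment> \<open>A deviation at stage 1 leads to babbling, where \<open>\<alpha>0\<close> is a
    best reply at the prior and so gives at most the concavification.\<close>
  have no_gain_u: "lin_ext u \<alpha>0 prior \<le> payoff prior u \<sigma> \<sigma> (\<tau>1 \<sigma> \<sigma>) (\<tau>2 \<sigma> \<sigma>) (\<alpha> \<sigma> \<sigma>)"
    unfolding on_path a_value by (rule lin_ext_le_cav[OF assms(1) \<alpha>0])
  \<comment> \<open>The \<open>u\<close> part is bounded as for expert 1, the \<open>v\<close> part
    by the value of information; the weights \<open>\<beta>\<close> and \<open>1 - \<beta>\<close>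
    are nonnegative.\<close>
  have no_gain_w2: "lin_ext w2 \<alpha>0 prior \<le> payoff prior w2 \<sigma> \<sigma> (\<tau>1 \<sigma> \<sigma>) (\<tau>2 \<sigma> \<sigma>) (\<alpha> \<sigma> \<sigma>)"
  proof -
    have "\<alpha>0 \<in> Delta" using \<alpha>0 by (simp add: BR_def)
    then have "lin_ext w2 \<alpha>0 prior \<le>
      \<beta> * (\<Sum>s\<in>\<sigma>. event_prob prior s * lin_ext u (a s) (posterior prior s)) +
      (1 - \<beta>) * (\<Sum>s\<in>\<sigma>. event_prob prior s * lin_ext v (a s) (posterior prior s))"
      unfolding w2 using \<beta> no_gain_u[unfolded on_path] BR_value_le_split[OF assms(1) \<sigma> _ a]
      by (intro add_mono mult_left_mono) auto
    also have "\<dots> = payoff prior w2 \<sigma> \<sigma> (\<tau>1 \<sigma> \<sigma>) (\<tau>2 \<sigma> \<sigma>) (\<alpha> \<sigma> \<sigma>)"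
      unfolding on_path w2 by (simp add: sum_distrib_left sum.distrib[symmetric] algebra_simps)
    finally show ?thesis .
  qed
  have "equilibrium prior u w2 v M1 M2 \<sigma> \<tau>1 \<sigma> \<tau>2 \<alpha> bel"
    unfolding equilibrium_def
  proof (intro conjI allI impI)
    fix \<rho> :: "'w stat_experiment" assume \<rho>: "is_experiment \<rho>"
    show "payoff prior u \<rho> \<sigma> (\<tau>1 \<rho> \<sigma>) (\<tau>2 \<sigma> \<rho>) (\<alpha> \<rho> \<sigma>) \<le> payoff prior u \<sigma> \<sigma> (\<tau>1 \<sigma> \<sigma>) (\<tau>2 \<sigma> \<sigma>) (\<alpha> \<sigma> \<sigma>)"
      using off_path[OF \<rho> \<sigma>] no_gain_u by (cases "\<rho> = \<sigma>") auto
    show "payoff prior w2 \<sigma> \<rho> (\<tau>1 \<sigma> \<rho>) (\<tau>2 \<rho> \<sigma>) (\<alpha> \<sigma> \<rho>) \<le> payoff prior w2 \<sigma> \<sigma> (\<tau>1 \<sigma> \<sigma>) (\<tau>2 \<sigma> \<sigma>) (\<alpha> \<sigma> \<sigma>)"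
      using off_path[OF \<sigma> \<rho>] no_gain_w2 by (cases "\<rho> = \<sigma>") auto
  qed (use \<sigma> subgames in auto)
  moreover have "truthful enc1 enc2 \<sigma> \<tau>1 \<sigma> \<tau>2"
    by (simp add: truthful_def \<tau>1_def \<tau>2_def)
  moreover have "payoff prior u \<sigma> \<sigma> (\<tau>1 \<sigma> \<sigma>) (\<tau>2 \<sigma> \<sigma>) (\<alpha> \<sigma> \<sigma>) = cav (ubar u v) prior"
    by (simp add: on_path a_value)
  ultimately show ?thesis unfolding w2_def by blast
qed

end
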